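(* Let $n\ge 2$. For integers $s,t$ define $$X_n(s,t) = \frac{1}{A_{n-1}} \Big(A_{n-1,t}\,(A_{n,s+1}-A_{n,s})-A_{n-1,s}\,(A_{n,t+1}-A_{n,t}) \Big).$$ Then for all integers $i,j$ with $1\le i<j\le n$, $$A_{n,i,j} = \sum_{p=0}^{n-j} \sum_{q=0}^p (-1)^q \binom{p}{q} X_n(i+q,\,j+p).$$
   Context: A monotone triangle of order $n$ is a triangular array $(t_{i,j})_{1\le i\le n,\,1\le j\le i}$ of integers satisfying $$t_{i,j} < t_{i,j+1}, \qquad t_{i,j} \le t_{i-1,j} \le t_{i,j+1} \qquad (2\le i\le n,\ 1\le j\le i-1).$$ Its bottom row is $(t_{n,1},\ldots,t_{n,n})$. For integers $k_1<k_2<\cdots<k_n$, let $\alpha_n(k_1,\ldots,k_n)$ denote the number of monotone triangles of order $n$ with bottom row $(k_1,\ldots,k_n)$; for $n=0$ use the convention that $\alpha_0$ of the empty list equals $1$. Define $$A_n = \alpha_n(1,2,\ldots,n),$$ $$A_{n,k} = \alpha_{n-1}(1,2,\ldots,\hat{k},\ldots,n)\quad (1\le k\le n),$$ $$A_{n,i,j} = \alpha_{n-2}(1,\ldots,\hat{i},\ldots,\hat{j},\ldots,n)\quad (1\le i<j\le n),$$ where $\hat{s}$ indicates that $s$ is omitted from the list. By convention $A_{n,k}=0$ if $k\notin[1,n]$ (so, likewise, $A_{n-1,k}=0$ if $k\notin[1,n-1]$). (Equivalently, in terms of alternating sign matrices (ASMs), i.e. $n\times n$ matrices with entries in $\{0,1,-1\}$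 in which every row and column sums to $1$ and has nonzero entries alternating in sign: $A_n$ is the number of ASMs of order $n$, and $A_{n,k}$ is the number of those whose unique $1$ in the first row is in column $k$.) *)

theory Defs
  imports Complex_Main "HOL-Library.FuncSet"
begin

definition triangle_index :: "nat \<Rightarrow> (nat \<times> nat) set" where
  "triangle_index n = {(i, j). 1 \<le> i \<and> i \<le> n \<and> 1 \<le> j \<and> j \<le> i}"

(* An array indexed by triangle_index n is a function that is undefined elsewhere, so
   that arrays with the same entries are equal and can be counted. *)
definition monotone_triangle :: "nat \<Rightarrow> (nat \<times> nat \<Rightarrow> int) \<Rightarrow> bool" where
  "monotone_triangle n t \<longleftrightarrow>
     t \<in> extensional (triangle_index n) \<and>
     (\<forall>i\<in>{2..n}. \<forall>j\<in>{1..i-1}.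
        t (i, j) < t (i, j+1) \<and> t (i, j) \<le> t (i-1, j) \<and> t (i-1, j) \<le> t (i, j+1))"

definition bottom_row :: "nat \<Rightarrow> (nat \<times> nat \<Rightarrow> int) \<Rightarrow> int list" where
  "bottom_row n t = map (\<lambda>j. t (n, j)) [1..<n+1]"

definition monotone_triangles :: "int list \<Rightarrow> (nat \<times> nat \<Rightarrow> int) set" where
  "monotone_triangles ks =
     {t. monotone_triangle (length ks) t \<and> bottom_row (length ks) t = ks}"

definition \<alpha> :: "int list \<Rightarrow> nat" where
  "\<alpha> ks = card (monotone_triangles ks)"

definition A1 :: "nat \<Rightarrow> nat" where
  "A1 n = \<alpha> [1..int n]"

definition A2 :: "nat \<Rightarrow> int \<Rightarrow> nat" where
  "A2 n k = (if 1 \<le> k \<and> k \<le> int n then \<alpha> (removeAll k [1..int n]) else 0)"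

(* Only used for 1 \<le> i < j \<le> n. *)
definition A3 :: "nat \<Rightarrow> int \<Rightarrow> int \<Rightarrow> nat" where
  "A3 n i j = \<alpha> (removeAll j (removeAll i [1..int n]))"

definition X :: "nat \<Rightarrow> int \<Rightarrow> int \<Rightarrow> rat" where
  "X n s t = 1 / of_nat (A1 (n-1)) *
     (of_nat (A2 (n-1) t) * (of_nat (A2 n (s+1)) - of_nat (A2 n s))
      - of_nat (A2 (n-1) s) * (of_nat (A2 n (t+1)) - of_nat (A2 n t)))"

lemma \<alpha>_Nil: "\<alpha> [] = 1"
proof -
  have "triangle_index 0 = {}"
    by (auto simp: triangle_index_def)
  then have "monotone_triangles [] = {\<lambda>_. undefined}"
    by (auto simp: monotone_triangles_def monotone_triangle_def bottom_row_def)
  then show ?thesis by (simp add: \<alpha>_def)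
qed

(* The cardinality in the definition of \<alpha> is a genuine count. *)
lemma finite_monotone_triangles: "finite (monotone_triangles ks)"
proof -
  define n where "n = length ks"
  define l where "l = Min (set ks)"
  define u where "u = Max (set ks)"
  have "t \<in> triangle_index n \<rightarrow>\<^sub>E {l..u}" if t: "t \<in> monotone_triangles ks" for t
  proof -
    have mt: "monotone_triangle n t" and br: "bottom_row n t = ks"
      using t by (auto simp: monotone_triangles_def n_def)
    have "i \<le> n \<Longrightarrow> \<forall>j\<in>{1..i}. t (i, j) \<in> {l..u}" for i
    proof (induction i rule: inc_induct)
      case base
      show ?case
      proof
        fix j assume "j \<in> {1..n}"
        then have "j \<in> set [1..<n+1]" by auto
        then have "t (n, j) \<in> set (bottom_row n t)"
          unfolding bottom_row_def set_map by (rule imageI)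
        then show "t (n, j) \<in> {l..u}" by (simp add: br l_def u_def)
      qed
    next
      case (step m)
      show ?case
      proof
        fix j assume j: "j \<in> {1..m}"
        have "t (Suc m, j) \<le> t (m, j) \<and> t (m, j) \<le> t (Suc m, j+1)"
        proof -
          have "Suc m \<in> {2..n}" "j \<in> {1..Suc m - 1}"
            using j step.hyps by auto
          then have "t (Suc m, j) \<le> t (Suc m - 1, j) \<and> t (Suc m - 1, j) \<le> t (Suc m, j+1)"
            using mt unfolding monotone_triangle_def by blast
          then show ?thesis by simp
        qed
        moreover have "t (Suc m, j) \<in> {l..u}" "t (Suc m, j+1) \<in> {l..u}"
          using step.IH j by auto
        ultimately show "t (m, j) \<in> {l..u}" by auto
      qed
    qed
    then show ?thesis
      using mt by (auto simp: monotone_triangle_def triangle_index_def PiE_iff)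
  qed
  moreover have "finite (triangle_index n)"
    by (rule finite_subset[of _ "{1..n} \<times> {1..n}"]) (auto simp: triangle_index_def)
  ultimately show ?thesis
    by (intro finite_subset[OF _ finite_PiE[of "triangle_index n" "\<lambda>_. {l..u}"]]) auto
qed

end

theory Submission
  imports Defs "HOL-Computational_Algebra.Polynomial"
begin

text \<open>
  Put \<open>W(i, j) = A\<^bsub>n,i,j\<^esub> - A\<^bsub>n,i,j+1\<^esub> + A\<^bsub>n,i+1,j+1\<^esub>\<close> for \<open>i < j\<close> and extend \<open>W\<close> antisymmetrically.
  Inverting the difference operator, the theorem is equivalent to \<open>W = X\<^bsub>n\<^esub>\<close>, so \<open>W\<close> must have rank 2.

  The generating function of \<open>W\<close> is \<open>v - u\<close> times a six-vertex partition function with domain wall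
  boundary in which two rows carry weights \<open>u\<close> and \<open>v\<close> and all other weights are 1.
  Let \<open>\<omega>\<close> be a primitive cube root of unity. In the spectral parameter \<open>x\<close> given by
  \<open>u = (x - \<omega>) / (1 - \<omega> x)\<close>, with row parameters \<open>x\<^sub>i\<close> and column parameters \<open>y\<^sub>j\<close>, the
  polynomial \<open>f x = Z x * (\<Prod>i. x - x\<^sub>i) * (\<Prod>j. x - y\<^sub>j)\<close> satisfies
  \<open>f x + \<omega> f (\<omega> x) + \<omega>\<^sup>2 f (\<omega>\<^sup>2 x) = 0\<close>: the left side has only exponents congruent to 2 modulo 3, and it
  vanishes at every \<open>y\<^sub>j\<close>, because a column can be moved to either side by the Yang-Baxter equation
  and then freezes at \<open>x = \<omega> y\<^sub>j\<close> and at \<open>x = \<omega>\<^sup>2 y\<^sub>j\<close>.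

  Letting all \<open>y\<^sub>j\<close> tend to 1, each column of \<open>W\<close> becomes a polynomial divisible by \<open>(x - 1)\<^bsup>2n-2\<^esup>\<close>
  with at most \<open>2 n\<close> terms. A nonzero polynomial with \<open>2 n\<close> terms cannot have a zero of order \<open>2 n\<close>
  at 1, so such a polynomial is determined by two numbers. Hence \<open>W\<close> has rank 2, and it is
  determined by its row sums \<open>A\<^bsub>n,s+1\<^esub> - A\<^bsub>n,s\<^esub>\<close> and its last column \<open>A\<^bsub>n-1,s\<^esub>\<close>.
\<close>

section \<open>Row transfer in the six-vertex model\<close>

definition \<omega> :: complex where
  "\<omega> = Complex (-1/2) (sqrt 3 / 2)"

lemma omega_sq: "\<omega> * \<omega> = - 1 - \<omega>"
  by (simp add: \<omega>_def complex_eq_iff)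

lemma omega_mult_sq: "\<omega> * (\<omega> * z) = - z - \<omega> * z"
proof -
  have "\<omega> * (\<omega> * z) = (\<omega> * \<omega>) * z" by (simp add: mult.assoc)
  then show ?thesis by (simp add: omega_sq algebra_simps)
qed

lemma omega_cube: "\<omega> ^ 3 = 1"
  by (simp add: power3_eq_cube omega_sq algebra_simps)

lemma omega_real_neq: "\<omega> * of_real r \<noteq> of_real s" if "r \<noteq> 0"
  using that by (simp add: \<omega>_def complex_eq_iff)

text \<open>
  A triple \<open>(a, b, c)\<close> holds the weights of one vertex; the entry 1 of an alternating sign matrix has
  weight 1, and the entry -1 has weight \<open>c\<close>. The first argument of \<open>transfer\<close> is the partial sum of
  the current row, a list entry is \<open>True\<close> if the partial sum of that column is 1, and \<open>F\<close> is applied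
  to the state below the row.
\<close>

type_synonym 'a weights = "'a \<times> 'a \<times> 'a"

abbreviation wa :: "'a weights \<Rightarrow> 'a" where "wa w \<equiv> fst w"
abbreviation wb :: "'a weights \<Rightarrow> 'a" where "wb w \<equiv> fst (snd w)"
abbreviation wc :: "'a weights \<Rightarrow> 'a" where "wc w \<equiv> snd (snd w)"

fun transfer :: "bool \<Rightarrow> 'a::comm_ring_1 weights list \<Rightarrow> bool list \<Rightarrow> (bool list \<Rightarrow> 'a) \<Rightarrow> 'a" where
  "transfer h [] [] F = (if h then F [] else 0)"
| "transfer False (w # ws) (False # s) F =
     wa w * transfer False ws s (\<lambda>t. F (False # t)) + transfer True ws s (\<lambda>t. F (True # t))"
| "transfer False (w # ws) (True # s) F = wb w * transfer False ws s (\<lambda>t. F (True # t))"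
| "transfer True (w # ws) (False # s) F = wb w * transfer True ws s (\<lambda>t. F (False # t))"
| "transfer True (w # ws) (True # s) F =
     wa w * transfer True ws s (\<lambda>t. F (True # t)) + wc w * transfer False ws s (\<lambda>t. F (False # t))"

lemma transfer_add:
  "length ws = length s \<Longrightarrow>
   transfer h ws s (\<lambda>t. F t + G t) = transfer h ws s F + transfer h ws s G"
proof (induction ws s arbitrary: h F G rule: list_induct2)
  case (Cons w ws x s)
  then show ?case by (cases h; cases x) (simp_all add: algebra_simps)
qed simp

lemma transfer_scale:
  "length ws = length s \<Longrightarrow> transfer h ws s (\<lambda>t. c * F t) = c * transfer h ws s F"
proof (induction ws s arbitrary: h F rule: list_induct2)
  case (Cons w ws x s)
  then show ?case by (cases h; cases x) (simp_all add: algebra_simps)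
qed simp

lemma transfer_cong:
  "length ws = length s \<Longrightarrow> (\<And>t. length t = length s \<Longrightarrow> F t = G t) \<Longrightarrow>
   transfer h ws s F = transfer h ws s G"
proof (induction ws s arbitrary: h F G rule: list_induct2)
  case (Cons w ws x s)
  have "transfer h' ws s (\<lambda>t. F (y # t)) = transfer h' ws s (\<lambda>t. G (y # t))" for h' y
    by (rule Cons.IH) (simp add: Cons.prems)
  then show ?case by (cases h; cases x) simp_all
qed simp

fun partition_fn :: "'a::comm_ring_1 weights list list \<Rightarrow> bool list \<Rightarrow> 'a" where
  "partition_fn [] s = (if False \<in> set s then 0 else 1)"
| "partition_fn (ws # wss) s = transfer False ws s (partition_fn wss)"

text \<open>Here \<open>(2 + \<omega>) / 3 = 1 / (1 - \<omega>)\<close>, which gives \<open>a\<^sup>2 - a b + b\<^sup>2 = c\<close>, and \<open>(1, 1, 1)\<close> for \<open>x = y = 1\<close>.\<close>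

definition vertex :: "complex \<Rightarrow> complex \<Rightarrow> complex weights" where
  "vertex x y = ((2 + \<omega>) / 3 * (x - \<omega> * y), (2 + \<omega>) / 3 * (y - \<omega> * x), x * y)"

text \<open>The R-matrix of two adjacent columns with parameters \<open>y\<close>, \<open>z\<close>, at positions \<open>k\<close> and \<open>k + 1\<close>.\<close>

fun rmat :: "complex \<Rightarrow> complex \<Rightarrow> nat \<Rightarrow> (bool list \<Rightarrow> complex) \<Rightarrow> bool list \<Rightarrow> complex" where
  "rmat y z 0 F (s1 # s2 # s) =
     (if s1 = s2 then (z - \<omega> * y) * F (s1 # s2 # s)
      else \<omega> * \<omega> * (y - z) * F (s2 # s1 # s) + (1 - \<omega>) * (if s1 then z else y) * F (s1 # s2 # s))"
| "rmat y z (Suc k) F (s1 # s) = rmat y z k (\<lambda>t. F (s1 # t)) s"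

lemma rmat_add: "length s \<ge> k + 2 \<Longrightarrow> rmat y z k (\<lambda>t. F t + G t) s = rmat y z k F s + rmat y z k G s"
proof (induction k arbitrary: F G s)
  case 0
  then obtain s1 s2 s' where "s = s1 # s2 # s'" by (cases s rule: remdups_adj.cases) auto
  then show ?case by (simp add: algebra_simps)
next
  case (Suc k)
  then show ?case by (cases s) auto
qed

lemma rmat_scale: "length s \<ge> k + 2 \<Longrightarrow> rmat y z k (\<lambda>t. c * F t) s = c * rmat y z k F s"
proof (induction k arbitrary: F s)
  case 0
  then obtain s1 s2 s' where "s = s1 # s2 # s'" by (cases s rule: remdups_adj.cases) auto
  then show ?case by (simp add: algebra_simps)
next
  case (Suc k)
  then show ?case by (cases s) auto
qed

lemma rmat_cong:
  "length s \<ge> k + 2 \<Longrightarrow> (\<And>t. length t = length s \<Longrightarrow> F t = G t) \<Longrightarrow> rmat y z k F s = rmat y z k G s"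
proof (induction k arbitrary: F G s)
  case 0
  then obtain s1 s2 s' where "s = s1 # s2 # s'" by (cases s rule: remdups_adj.cases) auto
  then show ?case using 0 by simp
next
  case (Suc k)
  from Suc.prems(1) obtain s1 s' where s: "s = s1 # s'" by (cases s) auto
  have "rmat y z k (\<lambda>t. F (s1 # t)) s' = rmat y z k (\<lambda>t. G (s1 # t)) s'"
    using Suc.prems by (intro Suc.IH) (simp_all add: s)
  then show ?case by (simp add: s)
qed

text \<open>In each of the eight cases for \<open>h\<close>, \<open>s1\<close>, \<open>s2\<close>,
  the coefficients of equal remaining transfers through \<open>vs\<close> agree as polynomials in
  \<open>x\<close>, \<open>y\<close>, \<open>z\<close> once \<omega>^2 is replaced by -1 -
  \<omega>.\<close>

lemma yang_baxter_local:
  assumes "length vs = length s"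
  shows "rmat y z 0 (\<lambda>s. transfer h (vertex x y # vertex x z # vs) s F) (s1 # s2 # s) =
    transfer h (vertex x z # vertex x y # vs) (s1 # s2 # s) (rmat y z 0 F)"
  using assms
  apply (cases h; cases s1; cases s2)
  apply (simp_all add: transfer_add transfer_scale vertex_def)
  apply (simp_all add: algebra_simps omega_mult_sq omega_sq)
  apply (simp_all add: field_simps)
  done

text \<open>The R-matrix leaves the first \<open>k\<close> entries of a state alone, so it passes
  through the columns \<open>us\<close> by linearity until the local identity applies.\<close>

lemma yang_baxter:
  "length us = k \<Longrightarrow> length s = k + 2 + length vs \<Longrightarrow>
   rmat y z k (\<lambda>s. transfer h (map (vertex x) (us @ y # z # vs)) s F) s =
   transfer h (map (vertex x) (us @ z # y # vs)) s (rmat y z k F)"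
proof (induction us arbitrary: k s h F)
  case Nil
  then obtain s1 s2 s' where s: "s = s1 # s2 # s'" by (cases s rule: remdups_adj.cases) auto
  have "length (map (vertex x) vs) = length s'" using Nil s by simp
  from yang_baxter_local[OF this] show ?case using Nil s by simp
next
  case (Cons u us)
  then obtain k' where k: "k = Suc k'" "length us = k'" by auto
  with Cons.prems obtain s1 s' where s: "s = s1 # s'" "length s' = k' + 2 + length vs"
    by (cases s) auto
  have len: "length (map (vertex x) (us @ y # z # vs)) = length s'" "length s' \<ge> k' + 2"
    using k s by simp_all
  have IH: "rmat y z k' (\<lambda>s. transfer h' (map (vertex x) (us @ y # z # vs)) s F') s' =
    transfer h' (map (vertex x) (us @ z # y # vs)) s' (rmat y z k' F')" for h' F'
    by (rule Cons.IH) (use k s in auto)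
  show ?case
    using IH unfolding s k by (cases h; cases s1) (simp_all add: rmat_add[OF len(2)] rmat_scale[OF len(2)])
qed

definition lattice :: "complex list \<Rightarrow> complex list \<Rightarrow> complex weights list list" where
  "lattice xs ys = map (\<lambda>x. map (vertex x) ys) xs"

lemma lattice_simps [simp]:
  "lattice [] ys = []" "lattice (x # xs) ys = map (vertex x) ys # lattice xs ys"
  by (simp_all add: lattice_def)

lemma rmat_zero: "length s \<ge> k + 2 \<Longrightarrow> rmat y z k (\<lambda>t. 0) s = 0"
  using rmat_scale[of k s y z 0 "\<lambda>_. 0"] by simp

lemma rmat_full:
  "length s \<ge> k + 2 \<Longrightarrow>
   rmat y z k (partition_fn []) s = (z - \<omega> * y) * partition_fn [] s"
proof (induction k arbitrary: s)
  case 0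
  then obtain s1 s2 s' where "s = s1 # s2 # s'" by (cases s rule: remdups_adj.cases) auto
  then show ?case by (cases s1; cases s2) auto
next
  case (Suc k)
  then obtain s1 s' where s: "s = s1 # s'" "length s' \<ge> k + 2" by (cases s) auto
  show ?case
  proof (cases s1)
    case True
    then show ?thesis using Suc.IH[OF s(2)] by (simp add: s)
  next
    case False
    then show ?thesis using rmat_zero[OF s(2)] by (simp add: s)
  qed
qed

text \<open>The R-matrix is pushed down through one row after another and ends at the full state,
  where it acts as the scalar \<open>z - \<omega> * y\<close>.\<close>

lemma rmat_partition_fn:
  "length s = length us + 2 + length vs \<Longrightarrow>
   rmat y z (length us) (partition_fn (lattice xs (us @ y # z # vs))) s =
   (z - \<omega> * y) * partition_fn (lattice xs (us @ z # y # vs)) s"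
proof (induction xs arbitrary: s)
  case Nil
  then have "length s \<ge> length us + 2" by simp
  from rmat_full[OF this] show ?case by (simp only: lattice_simps)
next
  case (Cons x xs)
  have len: "length (map (vertex x) (us @ z # y # vs)) = length s" using Cons.prems by simp
  have "rmat y z (length us) (partition_fn (lattice (x # xs) (us @ y # z # vs))) s =
    rmat y z (length us) (\<lambda>s. transfer False (map (vertex x) (us @ y # z # vs)) s
       (partition_fn (lattice xs (us @ y # z # vs)))) s"
    by (rule rmat_cong) (use Cons.prems in auto)
  also have "\<dots> = transfer False (map (vertex x) (us @ z # y # vs)) s
       (rmat y z (length us) (partition_fn (lattice xs (us @ y # z # vs))))"
    by (rule yang_baxter) (use Cons.prems in auto)
  also have "\<dots> = transfer False (map (vertex x) (us @ z # y # vs)) s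
       (\<lambda>t. (z - \<omega> * y) * partition_fn (lattice xs (us @ z # y # vs)) t)"
    by (rule transfer_cong[OF len]) (use Cons in auto)
  also have "\<dots> = (z - \<omega> * y) * partition_fn (lattice (x # xs) (us @ z # y # vs)) s"
    using transfer_scale[OF len] by simp
  finally show ?case .
qed

lemma rmat_empty:
  "rmat y z k F (replicate (k + 2 + m) False) = (z - \<omega> * y) * F (replicate (k + 2 + m) False)"
  by (induction k arbitrary: F) auto

section \<open>Symmetry in the column parameters and frozen columns\<close>

definition dwbc :: "complex list \<Rightarrow> complex list \<Rightarrow> complex" where
  "dwbc xs ys = partition_fn (lattice xs ys) (replicate (length ys) False)"

text \<open>On the empty state at the top the R-matrix is the same scalar
  \<open>z - \<omega> * y\<close> as on the full state at the bottom, and the scalar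
  cancels.\<close>

lemma dwbc_swap:
  assumes "z \<noteq> \<omega> * y"
  shows "dwbc xs (us @ y # z # vs) = dwbc xs (us @ z # y # vs)"
proof -
  let ?s = "replicate (length us + 2 + length vs) False"
  have "(z - \<omega> * y) * partition_fn (lattice xs (us @ y # z # vs)) ?s =
    (z - \<omega> * y) * partition_fn (lattice xs (us @ z # y # vs)) ?s"
    using rmat_partition_fn[of ?s us vs y z xs] rmat_empty[of y z "length us" _ "length vs"] by simp
  then show ?thesis using assms by (simp add: dwbc_def)
qed

text \<open>Positive reals never differ by a factor \<omega>, so adjacent columns with such
  parameters can always be exchanged. Moreover, distinct positive reals have distinct cubes, which
  the root count below relies on.\<close>

definition pos_real :: "complex \<Rightarrow> bool" where
  "pos_real y \<longleftrightarrow> (\<exists>r>0. y = of_real r)"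

lemma pos_real_omega: "pos_real y \<Longrightarrow> pos_real z \<Longrightarrow> z \<noteq> \<omega> * y"
  unfolding pos_real_def using omega_real_neq by (metis less_irrefl)

lemma dwbc_move_front:
  "pos_real y \<Longrightarrow> (\<forall>z\<in>set us. pos_real z) \<Longrightarrow> dwbc xs (us @ y # vs) = dwbc xs (y # us @ vs)"
proof (induction us arbitrary: vs rule: rev_induct)
  case (snoc z us)
  then have "dwbc xs (us @ z # y # vs) = dwbc xs (us @ y # z # vs)"
    by (intro dwbc_swap pos_real_omega) auto
  then show ?case using snoc by simp
qed simp

lemma dwbc_move_back:
  "pos_real y \<Longrightarrow> (\<forall>z\<in>set vs. pos_real z) \<Longrightarrow> dwbc xs (us @ y # vs) = dwbc xs (us @ vs @ [y])"
proof (induction vs arbitrary: us)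
  case (Cons z vs)
  then have "dwbc xs (us @ y # z # vs) = dwbc xs (us @ z # y # vs)"
    by (intro dwbc_swap pos_real_omega) auto
  then show ?case using Cons.IH[of "us @ [z]"] Cons.prems by simp
qed simp

text \<open>Rows enter with partial sum 0, so a leftmost column of sum 1 cannot take an entry -1:
  all its vertices are of type b.\<close>

lemma partition_fn_True_first:
  "length s = length ys \<Longrightarrow>
   partition_fn (lattice xs (y # ys)) (True # s) =
   (\<Prod>x\<leftarrow>xs. wb (vertex x y)) * partition_fn (lattice xs ys) s"
proof (induction xs arbitrary: s)
  case (Cons x xs)
  then have len: "length (map (vertex x) ys) = length s" by simp
  have "transfer False (map (vertex x) ys) s (\<lambda>t. partition_fn (lattice xs (y # ys)) (True # t)) =
    transfer False (map (vertex x) ys) s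
      (\<lambda>t. (\<Prod>x\<leftarrow>xs. wb (vertex x y)) * partition_fn (lattice xs ys) t)"
    by (rule transfer_cong[OF len]) (use Cons in auto)
  then show ?case unfolding transfer_scale[OF len] by simp
qed simp

text \<open>The row has to leave with partial sum 1. At a last column of sum 1 this excludes both an
  entry -1 and an incoming partial sum 0.\<close>

lemma transfer_True_last:
  "length ws = length s \<Longrightarrow>
   transfer h (ws @ [w]) (s @ [True]) F = wa w * transfer h ws s (\<lambda>t. F (t @ [True]))"
proof (induction ws s arbitrary: h F rule: list_induct2)
  case Nil
  then show ?case by (cases h) simp_all
next
  case (Cons w ws x s)
  then show ?case by (cases h; cases x) (simp_all add: algebra_simps)
qed

lemma partition_fn_True_last:
  "length s = length ys \<Longrightarrow>
   partition_fn (lattice xs (ys @ [y])) (s @ [True]) =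
   (\<Prod>x\<leftarrow>xs. wa (vertex x y)) * partition_fn (lattice xs ys) s"
proof (induction xs arbitrary: s)
  case (Cons x xs)
  then have len: "length (map (vertex x) ys) = length s" by simp
  have "transfer False (map (vertex x) ys) s (\<lambda>t. partition_fn (lattice xs (ys @ [y])) (t @ [True])) =
    transfer False (map (vertex x) ys) s
      (\<lambda>t. (\<Prod>x\<leftarrow>xs. wa (vertex x y)) * partition_fn (lattice xs ys) t)"
    by (rule transfer_cong[OF len]) (use Cons in auto)
  then show ?case unfolding transfer_scale[OF len] by (simp add: transfer_True_last[OF len])
qed simp

lemma transfer_True_empty:
  "transfer True ws (replicate (length ws) False) F =
   (\<Prod>w\<leftarrow>ws. wb w) * F (replicate (length ws) False)"
  by (induction ws arbitrary: F) (simp_all add: mult_ac)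

text \<open>Over empty columns the row has a single 1. Placing it before the last column costs the
  factor \<open>wb w\<close>, which is 0.\<close>

lemma transfer_False_empty_last:
  "wb w = 0 \<Longrightarrow> transfer False (ws @ [w]) (replicate (Suc (length ws)) False) F =
   (\<Prod>w\<leftarrow>ws. wa w) * F (replicate (length ws) False @ [True])"
proof (induction ws arbitrary: F)
  case (Cons v ws)
  have "transfer True (ws @ [w]) (replicate (length (ws @ [w])) False) (\<lambda>t. F (True # t)) = 0"
    unfolding transfer_True_empty using Cons.prems by simp
  then show ?case using Cons by (simp add: mult_ac)
qed simp

lemma dwbc_freeze_front:
  assumes "wa (vertex x y) = 0"
  shows "dwbc (x # xs) (y # ys) =
    (\<Prod>z\<leftarrow>ys. wb (vertex x z)) * (\<Prod>x\<leftarrow>xs. wb (vertex x y)) * dwbc xs ys"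
  using assms transfer_True_empty[of "map (vertex x) ys"]
  by (simp add: dwbc_def partition_fn_True_first o_def)

lemma dwbc_freeze_back:
  assumes "wb (vertex x y) = 0"
  shows "dwbc (x # xs) (ys @ [y]) =
    (\<Prod>z\<leftarrow>ys. wa (vertex x z)) * (\<Prod>x\<leftarrow>xs. wa (vertex x y)) * dwbc xs ys"
  using assms transfer_False_empty_last[of "vertex x y" "map (vertex x) ys"]
  by (simp add: dwbc_def partition_fn_True_last o_def)

section \<open>The three-term relation\<close>

text \<open>Degree bounds are written as vanishing of all coefficients from an index on, so that the
  bound 0 forces the zero polynomial, as \<open>first_row_poly\<close> requires when there are no
  columns.\<close>

lemma coeff_mult_linear_zero:
  fixes p :: "'a::comm_ring_1 poly"
  assumes "\<forall>m\<ge>N. coeff p m = 0" "\<forall>m\<ge>2. coeff q m = 0"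
  shows "\<forall>m\<ge>Suc N. coeff (q * p) m = 0"
proof (intro allI impI)
  fix m assume m: "m \<ge> Suc N"
  have "coeff q i * coeff p (m - i) = 0" if "i \<le> m" for i
    using assms m that by (cases "i \<ge> 2") auto
  then show "coeff (q * p) m = 0" by (simp add: coeff_mult)
qed

lemma coeff_linear_ge2: "m \<ge> 2 \<Longrightarrow> coeff [:a, b:] m = 0"
  by (rule coeff_eq_0) (simp add: degree_pCons_eq_if)

lemma prod_linear_poly:
  fixes a b :: "'b \<Rightarrow> 'a::comm_ring_1"
  shows "\<exists>p. (\<forall>m>length zs. coeff p m = 0) \<and> (\<forall>x. poly p x = (\<Prod>z\<leftarrow>zs. a z + x * b z))"
proof (induction zs)
  case Nil
  show ?case by (rule exI[of _ 1]) auto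
next
  case (Cons z zs)
  then obtain p where p: "\<forall>m\<ge>Suc (length zs). coeff p m = 0"
    "\<forall>x. poly p x = (\<Prod>z\<leftarrow>zs. a z + x * b z)" by (auto simp: Suc_le_eq)
  have "\<forall>m\<ge>Suc (Suc (length zs)). coeff ([:a z, b z:] * p) m = 0"
    by (rule coeff_mult_linear_zero) (use p coeff_linear_ge2 in auto)
  then show ?case using p(2) by (intro exI[of _ "[:a z, b z:] * p"]) (auto simp: Suc_le_eq algebra_simps)
qed

text \<open>Over empty columns a row consists of one entry 1, of weight 1, and zeros whose weights
  are linear in \<open>x\<close>. Hence the degree is below the number of columns.\<close>

lemma first_row_poly:
  "\<exists>p. (\<forall>m\<ge>length ys. coeff p m = 0) \<and>
    (\<forall>x. poly p x = transfer False (map (vertex x) ys) (replicate (length ys) False) F)"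
proof (induction ys arbitrary: F)
  case Nil
  show ?case by (rule exI[of _ 0]) auto
next
  case (Cons y ys)
  obtain p where p: "\<forall>m\<ge>length ys. coeff p m = 0"
    "\<forall>x. poly p x = transfer False (map (vertex x) ys) (replicate (length ys) False) (\<lambda>t. F (False # t))"
    using Cons by blast
  obtain q where q: "\<forall>m>length ys. coeff q m = 0"
    "\<forall>x. poly q x = (\<Prod>z\<leftarrow>ys. (2 + \<omega>) / 3 * z + x * (- (2 + \<omega>) / 3 * \<omega>))"
    using prod_linear_poly[of ys "\<lambda>z. (2 + \<omega>) / 3 * z" "\<lambda>_. - (2 + \<omega>) / 3 * \<omega>"] by blast
  let ?l = "[:- (2 + \<omega>) / 3 * \<omega> * y, (2 + \<omega>) / 3:]"
  let ?c = "F (True # replicate (length ys) False)"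
  have b: "wb (vertex x z) = (2 + \<omega>) / 3 * z + x * (- (2 + \<omega>) / 3 * \<omega>)" for x z
    by (simp add: vertex_def field_simps)
  have a: "wa (vertex x y) = poly ?l x" for x
    by (simp add: vertex_def field_simps)
  have "\<forall>m\<ge>Suc (length ys). coeff (?l * p) m = 0"
    by (rule coeff_mult_linear_zero) (use p coeff_linear_ge2 in auto)
  then have "\<forall>m\<ge>length (y # ys). coeff (?l * p + smult ?c q) m = 0"
    using q(1) by (simp del: mult_pCons_left)
  moreover have "poly (?l * p + smult ?c q) x = transfer False (map (vertex x) (y # ys))
    (replicate (length (y # ys)) False) F" for x
  proof -
    have "transfer True (map (vertex x) ys) (replicate (length ys) False) (\<lambda>t. F (True # t)) =
      poly (smult ?c q) x"
      using transfer_True_empty[of "map (vertex x) ys" "\<lambda>t. F (True # t)"] q(2) b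
      by (simp add: o_def)
    then show ?thesis using p(2) a[of x] by (simp del: poly_pCons mult_pCons_left)
  qed
  ultimately show ?case by blast
qed

lemma poly_eq_sum_lessThan:
  fixes p :: "'a::comm_ring_1 poly"
  assumes "\<forall>m\<ge>N. coeff p m = 0"
  shows "poly p x = (\<Sum>m<N. coeff p m * x ^ m)"
  unfolding poly_altdef
proof (rule sum.mono_neutral_cong)
  fix i assume "i \<in> {..<N} - {..degree p}"
  then show "coeff p i * x ^ i = 0" by (simp add: coeff_eq_0)
qed (use assms in auto)

text \<open>A filter on exponents: x^m is multiplied by 1 + z + z^2 with z = \<omega>^(m+1), which
  is 3 if m is 2 modulo 3, and 0 otherwise.\<close>

definition tripled :: "(complex \<Rightarrow> complex) \<Rightarrow> complex \<Rightarrow> complex" where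
  "tripled f x = f x + \<omega> * f (\<omega> * x) + \<omega> ^ 2 * f (\<omega> ^ 2 * x)"

lemma tripled_monom:
  "tripled (\<lambda>x. c * x ^ m) x = c * x ^ m * (1 + \<omega> ^ (m + 1) + (\<omega> ^ (m + 1)) ^ 2)"
  by (simp add: tripled_def power_mult_distrib algebra_simps power2_eq_square power_add)

lemma tripled_power_sum:
  "tripled (\<lambda>x. \<Sum>m<3 * N + 2. c m * x ^ m) x = 3 * x ^ 2 * (\<Sum>k<N. c (3 * k + 2) * (x ^ 3) ^ k)"
proof -
  have tr: "tripled (\<lambda>x. f x + g x) x = tripled f x + tripled g x" for f g
    by (simp add: tripled_def algebra_simps)
  have o3: "\<omega> ^ (3 * k) = 1" for k by (simp add: power_mult omega_cube)
  have *: "tripled (\<lambda>x. c (3 * k) * x ^ (3 * k)) x = 0"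
    "tripled (\<lambda>x. c (3 * k + 1) * x ^ (3 * k + 1)) x = 0"
    "tripled (\<lambda>x. c (3 * k + 2) * x ^ (3 * k + 2)) x = 3 * c (3 * k + 2) * x ^ (3 * k + 2)" for k
    unfolding tripled_monom
    by (simp_all add: power_add o3 o3[unfolded mult.commute[of 3]] power2_eq_square omega_sq
        algebra_simps omega_mult_sq)
  show ?thesis
  proof (induction N)
    case 0
    show ?case using *(1,2)[of 0] by (simp add: numeral_2_eq_2 tr)
  next
    case (Suc N)
    have "3 * Suc N + 2 = Suc (Suc (Suc (3 * N + 2)))" by simp
    then have "tripled (\<lambda>x. \<Sum>m<3 * Suc N + 2. c m * x ^ m) x =
      tripled (\<lambda>x. \<Sum>m<3 * N + 2. c m * x ^ m) x +
      tripled (\<lambda>x. c (3 * N + 2) * x ^ (3 * N + 2)) x +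
      tripled (\<lambda>x. c (3 * (N + 1)) * x ^ (3 * (N + 1))) x +
      tripled (\<lambda>x. c (3 * (N + 1) + 1) * x ^ (3 * (N + 1) + 1)) x"
      by (simp only: tr[symmetric]) (simp add: algebra_simps numeral_3_eq_3 numeral_2_eq_2)
    also have "\<dots> = 3 * x ^ 2 * (\<Sum>k<Suc N. c (3 * k + 2) * (x ^ 3) ^ k)"
    proof -
      have "x ^ (3 * N + 2) = x ^ 2 * (x ^ 3) ^ N" by (simp only: power_add power_mult mult.commute[of "x^2"])
      note pow = this
      show ?thesis
        by (simp only: Suc.IH *, simp only: pow)
          (simp only: sum.lessThan_Suc distrib_left add_0_right mult_ac)
    qed
    finally show ?case .
  qed
qed

definition scaled_dwbc :: "complex list \<Rightarrow> complex list \<Rightarrow> complex \<Rightarrow> complex" where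
  "scaled_dwbc xs ys x = (\<Prod>z\<leftarrow>xs. x - z) * (\<Prod>y\<leftarrow>ys. x - y) * dwbc (x # xs) ys"

text \<open>The two prefactors have degrees \<open>N\<close> and \<open>N + 1\<close>, and the
  partition function has degree at most \<open>N\<close> in \<open>x\<close>.\<close>

lemma scaled_dwbc_poly:
  assumes "length ys = Suc N" "length xs = N"
  shows "\<exists>p. (\<forall>m\<ge>3 * N + 2. coeff p m = 0) \<and> (\<forall>x. poly p x = scaled_dwbc xs ys x)"
proof -
  obtain p where p: "\<forall>m\<ge>length ys. coeff p m = 0" "\<forall>x. poly p x = dwbc (x # xs) ys"
    using first_row_poly[of ys "partition_fn (lattice xs ys)"]
    unfolding dwbc_def lattice_simps partition_fn.simps by blast
  obtain q where q: "\<forall>m>length (xs @ ys). coeff q m = 0"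
     "\<forall>x. poly q x = (\<Prod>z\<leftarrow>xs @ ys. - z + x * 1)"
    using prod_linear_poly[of "xs @ ys" uminus "\<lambda>_. 1"] by blast
  have "coeff (q * p) m = 0" if m: "m \<ge> 3 * N + 2" for m
  proof -
    have "coeff q i * coeff p (m - i) = 0" if "i \<le> m" for i
      using p(1) q(1) that m assms by (cases "i > 2 * N + 1") auto
    then show ?thesis unfolding coeff_mult by (intro sum.neutral ballI) auto
  qed
  then show ?thesis using p(2) q(2)
    by (intro exI[of _ "q * p"]) (auto simp: scaled_dwbc_def)
qed

lemma prod_list_times:
  fixes f g :: "'b \<Rightarrow> 'a::comm_ring_1"
  shows "(\<Prod>z\<leftarrow>zs. f z * g z) = (\<Prod>z\<leftarrow>zs. f z) * (\<Prod>z\<leftarrow>zs. g z)"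
  by (induction zs) (simp_all add: mult_ac)

lemma prod_list_scale:
  fixes f :: "'b \<Rightarrow> 'a::comm_ring_1"
  shows "(\<Prod>z\<leftarrow>zs. c * f z) = c ^ length zs * (\<Prod>z\<leftarrow>zs. f z)"
  by (induction zs) (simp_all add: mult_ac)

text \<open>At \<open>y\<close> itself the factor x - y vanishes. At \<omega> y the column is moved
  to the front, where its corner weight a is 0; at \<omega>^2 y it is moved to the back, where its
  corner weight b is 0. Both frozen values contain \<open>dwbc xs zs\<close>, and their other
  factors are compared one by one.\<close>

lemma scaled_dwbc_root:
  assumes "y \<in> set ys" "\<forall>y\<in>set ys. pos_real y" "length ys = Suc N" "length xs = N"
  shows "tripled (scaled_dwbc xs ys) y = 0"
proof -
  obtain us vs where ys: "ys = us @ y # vs" using assms(1) by (meson split_list)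
  define zs where "zs = us @ vs"
  let ?k = "(2 + \<omega>) / 3"
  have pos: "pos_real y" "\<forall>y\<in>set us. pos_real y" "\<forall>y\<in>set vs. pos_real y"
    using assms(2) ys by auto
  have prod_ys: "(\<Prod>y\<leftarrow>ys. x - y) = (x - y) * (\<Prod>z\<leftarrow>zs. x - z)" for x
    by (simp add: ys zs_def)
  have len: "length zs = length xs" using assms ys zs_def by simp
  have z1: "wa (vertex (\<omega> * y) y) = 0" by (simp add: vertex_def)
  have z2: "wb (vertex (\<omega>\<^sup>2 * y) y) = 0"
    by (simp add: vertex_def power2_eq_square omega_sq algebra_simps omega_mult_sq)
  have f1: "scaled_dwbc xs ys (\<omega> * y) = (\<omega> * y - y) *
     (\<Prod>z\<leftarrow>xs. (\<omega> * y - z) * wb (vertex z y)) * (\<Prod>z\<leftarrow>zs. (\<omega> * y - z) * wb (vertex (\<omega> * y) z)) *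
     dwbc xs zs"
    unfolding scaled_dwbc_def prod_ys prod_list_times
    using dwbc_move_front[OF pos(1,2), of "\<omega> * y # xs" vs] dwbc_freeze_front[OF z1, of xs zs]
    by (simp only: ys zs_def mult_ac)
  have f2: "scaled_dwbc xs ys (\<omega>\<^sup>2 * y) = (\<omega>\<^sup>2 * y - y) *
     (\<Prod>z\<leftarrow>xs. (\<omega>\<^sup>2 * y - z) * wa (vertex z y)) * (\<Prod>z\<leftarrow>zs. (\<omega>\<^sup>2 * y - z) * wa (vertex (\<omega>\<^sup>2 * y) z)) *
     dwbc xs zs"
    unfolding scaled_dwbc_def prod_ys prod_list_times
    using dwbc_move_back[OF pos(1,3), of "\<omega>\<^sup>2 * y # xs" us] dwbc_freeze_back[OF z2, of xs zs]
    by (simp only: ys zs_def mult_ac append_assoc)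
  \<comment> \<open>Each of the \<open>N\<close> other rows gives the ratio -\<omega>, and below
    each of the \<open>N\<close> other columns gives -\<omega>^2; together these powers multiply to
    1.\<close>
  have "(\<omega> * y - z) * wb (vertex z y) = - \<omega> * ((\<omega>\<^sup>2 * y - z) * wa (vertex z y))" for z
    by (simp add: vertex_def power2_eq_square omega_sq algebra_simps omega_mult_sq)
  then have r1: "(\<Prod>z\<leftarrow>xs. (\<omega> * y - z) * wb (vertex z y)) =
     (- \<omega>) ^ N * (\<Prod>z\<leftarrow>xs. (\<omega>\<^sup>2 * y - z) * wa (vertex z y))"
    using assms(4) by (simp only: prod_list_scale)
  have "(\<omega> * y - z) * wb (vertex (\<omega> * y) z) = - (\<omega>\<^sup>2) * ((\<omega>\<^sup>2 * y - z) * wa (vertex (\<omega>\<^sup>2 * y) z))" for z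
    by (simp add: vertex_def power2_eq_square omega_sq algebra_simps omega_mult_sq) (simp add: field_simps)
  then have r2: "(\<Prod>z\<leftarrow>zs. (\<omega> * y - z) * wb (vertex (\<omega> * y) z)) =
     (- (\<omega>\<^sup>2)) ^ N * (\<Prod>z\<leftarrow>zs. (\<omega>\<^sup>2 * y - z) * wa (vertex (\<omega>\<^sup>2 * y) z))"
    using assms(4) len by (simp only: prod_list_scale)
  have one: "(- \<omega>) ^ N * (- (\<omega>\<^sup>2)) ^ N = 1"
    unfolding power_mult_distrib[symmetric] using omega_cube by (simp add: power2_eq_square power3_eq_cube mult.assoc)
  have "scaled_dwbc xs ys (\<omega> * y) = ((- \<omega>) ^ N * (- (\<omega>\<^sup>2)) ^ N) * ((\<omega> * y - y) *
     (\<Prod>z\<leftarrow>xs. (\<omega>\<^sup>2 * y - z) * wa (vertex z y)) * (\<Prod>z\<leftarrow>zs. (\<omega>\<^sup>2 * y - z) * wa (vertex (\<omega>\<^sup>2 * y) z)) *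
     dwbc xs zs)"
    unfolding f1 r1 r2 by (simp only: mult_ac)
  moreover have "\<omega> * (\<omega> * y - y) + \<omega>\<^sup>2 * (\<omega>\<^sup>2 * y - y) = 0"
    by (simp add: power2_eq_square omega_sq algebra_simps omega_mult_sq)
  moreover have "\<omega> * (a * p * q * r) + \<omega>\<^sup>2 * (b * p * q * r) = (\<omega> * a + \<omega>\<^sup>2 * b) * (p * q * r)"
    for a b p q r by (simp add: algebra_simps)
  ultimately have "\<omega> * scaled_dwbc xs ys (\<omega> * y) + \<omega>\<^sup>2 * scaled_dwbc xs ys (\<omega>\<^sup>2 * y) = 0"
    by (simp only: f2 one mult_1 mult_zero_left)
  moreover have "scaled_dwbc xs ys y = 0" by (simp add: scaled_dwbc_def prod_ys)
  ultimately show ?thesis by (simp add: tripled_def)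
qed

text \<open>The filter leaves x^2 times a polynomial in x^3 with at most \<open>N\<close>
  coefficients, and this polynomial vanishes at the \<open>N + 1\<close> distinct cubes of the
  column parameters.\<close>

lemma tripled_scaled_dwbc_distinct:
  assumes "distinct ys" "\<forall>y\<in>set ys. pos_real y" "length ys = Suc N" "length xs = N"
  shows "tripled (scaled_dwbc xs ys) x = 0"
proof -
  obtain p where p: "\<forall>m\<ge>3 * N + 2. coeff p m = 0" "\<forall>x. poly p x = scaled_dwbc xs ys x"
    using scaled_dwbc_poly[OF assms(3,4)] by blast
  have eq: "scaled_dwbc xs ys = (\<lambda>x. \<Sum>m<3 * N + 2. coeff p m * x ^ m)"
    using poly_eq_sum_lessThan[OF p(1)] p(2) by auto
  define q where "q = (\<Sum>k<N. monom (coeff p (3 * k + 2)) k)"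
  have tr: "tripled (scaled_dwbc xs ys) x = 3 * x ^ 2 * poly q (x ^ 3)" for x
    unfolding eq tripled_power_sum by (simp add: q_def poly_sum poly_monom)
  have deg: "degree q \<le> N"
    unfolding q_def by (rule degree_sum_le) (auto intro: order.trans[OF degree_monom_le])
  have "(\<lambda>y. y ^ 3) ` set ys \<subseteq> {z. poly q z = 0}"
  proof safe
    fix y assume y: "y \<in> set ys"
    then have "y \<noteq> 0" using assms(2) by (auto simp: pos_real_def)
    then show "poly q (y ^ 3) = 0"
      using scaled_dwbc_root[OF y assms(2-4)] tr[of y] by simp
  qed
  moreover have "inj_on (\<lambda>y. y ^ 3) (set ys)"
  proof (rule inj_onI)
    fix y z :: complex assume yz: "y \<in> set ys" "z \<in> set ys" "y ^ 3 = z ^ 3"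
    obtain r where r: "r > 0" "y = of_real r" using yz(1) assms(2) by (auto simp: pos_real_def)
    obtain s where s: "s > 0" "z = of_real s" using yz(2) assms(2) by (auto simp: pos_real_def)
    have "r ^ 3 = s ^ 3" using yz(3) unfolding r s by (metis of_real_eq_iff of_real_power)
    then show "y = z" using r s by (simp add: power_eq_iff_eq_base)
  qed
  then have "card ((\<lambda>y. y ^ 3) ` set ys) = Suc N"
    using assms by (simp add: card_image distinct_card)
  ultimately have "\<not> q \<noteq> 0"
    using card_poly_roots_bound[of q] deg card_mono[OF poly_roots_finite[of q], of "(\<lambda>y. y ^ 3) ` set ys"]
    by linarith
  then show ?thesis using tr by simp
qed

section \<open>Merging the column parameters by continuity\<close>

lemma continuous_on_transfer:
  fixes F :: "real \<Rightarrow> bool list \<Rightarrow> complex"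
  shows "length gs = length s \<Longrightarrow> (\<forall>g\<in>set gs. continuous_on UNIV g) \<Longrightarrow>
   (\<And>t. length t = length s \<Longrightarrow> continuous_on UNIV (\<lambda>e. F e t)) \<Longrightarrow>
   continuous_on UNIV (\<lambda>e. transfer h (map (\<lambda>g. vertex x (g e)) gs) s (F e))"
proof (induction gs s arbitrary: h F rule: list_induct2)
  case Nil
  then show ?case by (cases h) simp_all
next
  case (Cons g gs y s)
  have IH: "continuous_on UNIV (\<lambda>e. transfer h' (map (\<lambda>g. vertex x (g e)) gs) s (\<lambda>t. F e (b # t)))"
    for h' b
    by (rule Cons.IH) (use Cons.prems in auto)
  have g: "continuous_on UNIV g" using Cons.prems by simp
  have w: "continuous_on UNIV (\<lambda>e. wa (vertex x (g e)))" "continuous_on UNIV (\<lambda>e. wb (vertex x (g e)))"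
    "continuous_on UNIV (\<lambda>e. wc (vertex x (g e)))"
    unfolding vertex_def by (auto intro!: continuous_intros g)
  show ?case
    by (cases h; cases y; simp only: transfer.simps list.map)
      (intro continuous_on_add continuous_on_mult IH w)+
qed

lemma continuous_on_partition_fn:
  "(\<forall>g\<in>set gs. continuous_on UNIV g) \<Longrightarrow> length s = length gs \<Longrightarrow>
   continuous_on UNIV (\<lambda>e::real. partition_fn (lattice xs (map (\<lambda>g. g e) gs)) s)"
proof (induction xs arbitrary: s)
  case (Cons x xs)
  then have "continuous_on UNIV (\<lambda>e. transfer False (map (\<lambda>g. vertex x (g e)) gs) s
     (partition_fn (lattice xs (map (\<lambda>g. g e) gs))))"
    by (intro continuous_on_transfer) auto
  then show ?case by (simp add: o_def)
qed simp

lemma zero_at_right_limit: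
  fixes f :: "real \<Rightarrow> complex"
  assumes "continuous_on UNIV f" "\<And>e. e > 0 \<Longrightarrow> f e = 0"
  shows "f 0 = 0"
proof -
  have "(f \<longlongrightarrow> f 0) (at 0)"
    using assms(1) by (simp add: continuous_on_eq_continuous_at isCont_def)
  then have "(f \<longlongrightarrow> f 0) (at_right 0)" by (rule tendsto_mono[rotated]) (simp add: at_le)
  moreover have "eventually (\<lambda>e. f e = 0) (at_right 0)"
    using assms(2) by (auto simp: eventually_at_filter)
  then have "(f \<longlongrightarrow> 0) (at_right 0)" by (simp add: tendsto_eventually)
  ultimately show ?thesis by (rule tendsto_unique[rotated]) simp
qed

lemma continuous_on_prod_list_diff:
  "(\<forall>g\<in>set gs. continuous_on UNIV g) \<Longrightarrow>
   continuous_on UNIV (\<lambda>e::real. \<Prod>g\<leftarrow>gs. x - (g e :: complex))"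
  by (induction gs) (auto intro!: continuous_intros)

lemma tripled_scaled_dwbc:
  assumes "length xs = N"
  shows "tripled (scaled_dwbc xs (replicate (Suc N) 1)) x = 0"
proof -
  (* The column parameters 1 + j e are distinct for e > 0 and merge at e = 0. *)
  define gs where "gs = map (\<lambda>j e. complex_of_real (1 + real j * e)) [0..<Suc N]"
  define ys where "ys e = map (\<lambda>g. g e) gs" for e
  have cont: "\<forall>g\<in>set gs. continuous_on UNIV g"
    unfolding gs_def by (auto intro!: continuous_intros)
  have "continuous_on UNIV (\<lambda>e. scaled_dwbc xs (ys e) x)" for x
  proof -
    have "continuous_on UNIV (\<lambda>e. partition_fn (lattice (x # xs) (ys e)) (replicate (length gs) False))"
      unfolding ys_def by (rule continuous_on_partition_fn) (use cont in auto)
    moreover have "continuous_on UNIV (\<lambda>e. \<Prod>y\<leftarrow>ys e. x - y)"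
      using continuous_on_prod_list_diff[OF cont] by (simp add: ys_def o_def)
    ultimately show ?thesis
      unfolding scaled_dwbc_def dwbc_def by (auto simp: ys_def intro!: continuous_intros)
  qed
  then have c: "continuous_on UNIV (\<lambda>e. tripled (scaled_dwbc xs (ys e)) x)"
    unfolding tripled_def by (intro continuous_intros)
  have "tripled (scaled_dwbc xs (ys e)) x = 0" if "e > 0" for e
  proof (rule tripled_scaled_dwbc_distinct)
    show "distinct (ys e)"
      using that by (auto simp: ys_def gs_def distinct_map o_def intro!: inj_onI)
    show "\<forall>y\<in>set (ys e). pos_real y"
    proof
      fix y assume "y \<in> set (ys e)"
      then obtain j where "y = complex_of_real (1 + real j * e)"
        by (auto simp: ys_def gs_def)
      then show "pos_real y"
        using that unfolding pos_real_def by (intro exI[of _ "1 + real j * e"]) (simp add: add_pos_nonneg)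
    qed
  qed (use assms in \<open>simp_all add: ys_def gs_def\<close>)
  from zero_at_right_limit[OF c this] have "tripled (scaled_dwbc xs (ys 0)) x = 0" by simp
  moreover have "ys 0 = replicate (Suc N) 1"
    by (simp add: ys_def gs_def o_def map_replicate_const replicate_append_same)
  ultimately show ?thesis by simp
qed

section \<open>Two rows with general weights\<close>

definition rescale :: "'a::comm_ring_1 \<Rightarrow> 'a weights \<Rightarrow> 'a weights" where
  "rescale c w = (c * wa w, c * wb w, c ^ 2 * wc w)"

text \<open>Entries 1 carry no factor \<open>c\<close>, and entries -1 carry two. A row entered with
  sum 1 has equally many of both, hence the factor c^n; entered with sum 0 it has one more 1, hence
  c^(n-1), written with an extra \<open>c\<close> on the left.\<close>

lemma transfer_rescale:
  "length ws = length s \<Longrightarrow>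
   transfer True (map (rescale c) ws) s F = c ^ length ws * transfer True ws s F \<and>
   c * transfer False (map (rescale c) ws) s F = c ^ length ws * transfer False ws s F"
proof (induction ws s arbitrary: F rule: list_induct2)
  case (Cons w ws x s)
  have T: "transfer True (map (rescale c) ws) s F = c ^ length ws * transfer True ws s F"
    and F: "c * transfer False (map (rescale c) ws) s F = c ^ length ws * transfer False ws s F" for F
    using Cons.IH by auto
  have F': "c * (y * transfer False (map (rescale c) ws) s F) = y * (c ^ length ws * transfer False ws s F)" for y F
    using F[of F] by (metis mult.left_commute)
  show ?case
    by (cases x) (simp_all add: rescale_def[of _ w] T F' F algebra_simps power2_eq_square)
qed simp

text \<open>Weights normalized to b = 1, where the entry -1 has weight a^2 - a b + b^2. The value
  \<open>u = 1\<close> gives the plain count.\<close>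

definition hom_weights :: "'a::comm_ring_1 \<Rightarrow> 'a weights" where
  "hom_weights u = (u, 1, u ^ 2 - u + 1)"

abbreviation two_rows :: "'a::comm_ring_1 \<Rightarrow> 'a \<Rightarrow> bool \<Rightarrow> bool \<Rightarrow> nat \<Rightarrow> (bool list \<Rightarrow> 'a) \<Rightarrow> 'a" where
  "two_rows u v h h' n F \<equiv> transfer h (replicate n (hom_weights u)) (replicate n False)
     (\<lambda>s. transfer h' (replicate n (hom_weights v)) s F)"

lemma hom_weights_simps:
  "wa (hom_weights u) = u" "wb (hom_weights u) = 1" "wc (hom_weights u) = u ^ 2 - u + 1"
  by (simp_all add: hom_weights_def)

definition mark1 :: "nat \<Rightarrow> nat \<Rightarrow> bool list" where
  "mark1 j n = map (\<lambda>k. k = j) [0..<n]"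

definition mark2 :: "nat \<Rightarrow> nat \<Rightarrow> nat \<Rightarrow> bool list" where
  "mark2 i j n = map (\<lambda>k. k = i \<or> k = j) [0..<n]"

lemma mark1_simps:
  "mark1 0 (Suc n) = True # replicate n False" "mark1 (Suc j) (Suc n) = False # mark1 j n"
  by (simp_all add: mark1_def map_upt_Suc map_replicate_const del: upt_Suc)

lemma mark2_simps:
  "mark2 0 (Suc j) (Suc n) = True # mark1 j n" "mark2 (Suc i) (Suc j) (Suc n) = False # mark2 i j n"
  by (simp_all add: mark1_def mark2_def map_upt_Suc del: upt_Suc)

lemma transfer_True_hom:
  "transfer True (replicate n (hom_weights u)) (replicate n False) F = F (replicate n False)"
  by (induction n arbitrary: F) (simp_all add: hom_weights_simps)

lemma transfer_False_hom:
  "transfer False (replicate n (hom_weights u)) (replicate n False) F = (\<Sum>j<n. u ^ j * F (mark1 j n))"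
proof (induction n arbitrary: F)
  case (Suc n)
  show ?case
    unfolding sum.lessThan_Suc_shift
    by (simp add: Suc transfer_True_hom mark1_simps hom_weights_simps sum_distrib_left mult_ac)
qed simp

text \<open>The first column is split off. Once both rows have partial sum 1, all later columns are
  forced and have weight 1, which gives the terms with \<open>replicate n False\<close>.\<close>

lemma two_rows_simps:
  "two_rows u v False False (Suc n) F =
     u * v * two_rows u v False False n (\<lambda>t. F (False # t)) +
     (u * two_rows u v False True n (\<lambda>t. F (True # t)) + two_rows u v True False n (\<lambda>t. F (True # t)))"
  "two_rows u v False True (Suc n) F =
     u * two_rows u v False True n (\<lambda>t. F (False # t)) + v * F (True # replicate n False) +
     (v ^ 2 - v + 1) * two_rows u v True False n (\<lambda>t. F (False # t))"
  "two_rows u v True False (Suc n) F =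
     v * two_rows u v True False n (\<lambda>t. F (False # t)) + F (True # replicate n False)"
  by (simp_all add: hom_weights_simps transfer_add transfer_scale transfer_True_hom mult.assoc
      distrib_left add_ac)

text \<open>This combination is what follows the first column of final sum 1 in the recursion for
  \<open>two_rows u v False False\<close>; the factor \<open>u - v\<close> clears the denominator of
  the geometric sums.\<close>

lemma two_rows_mixed:
  "(u - v) * (u * two_rows u v False True n F + two_rows u v True False n F) =
   (\<Sum>j<n. (u ^ Suc j * (1 - v + u * v) - v ^ Suc j * (1 - u + u * v)) * F (mark1 j n))"
proof (induction n arbitrary: F)
  case (Suc n)
  let ?G = "\<lambda>t. F (False # t)"
  let ?S = "two_rows u v False True n ?G" and ?R = "two_rows u v True False n ?G"
  let ?T = "F (True # replicate n False)"
  have R: "?R = (\<Sum>j<n. v ^ j * ?G (mark1 j n))"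
    by (simp add: transfer_True_hom transfer_False_hom)
  have "(\<Sum>j<n. (u ^ Suc (Suc j) * (1 - v + u * v) - v ^ Suc (Suc j) * (1 - u + u * v)) * ?G (mark1 j n)) =
    u * (\<Sum>j<n. (u ^ Suc j * (1 - v + u * v) - v ^ Suc j * (1 - u + u * v)) * ?G (mark1 j n)) +
    (u - v) * v * (1 - u + u * v) * (\<Sum>j<n. v ^ j * ?G (mark1 j n))"
    unfolding sum_distrib_left sum.distrib[symmetric]
    by (rule sum.cong) (simp_all add: algebra_simps)
  also have "\<dots> = u * ((u - v) * (u * ?S + ?R)) + (u - v) * v * (1 - u + u * v) * ?R"
    by (simp only: R[symmetric] Suc.IH[of ?G])
  finally show ?case
    unfolding sum.lessThan_Suc_shift mark1_simps two_rows_simps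
    by (simp add: algebra_simps power2_eq_square)
qed simp

text \<open>The factors 1 - u + u v and 1 - v + u v express \<open>mixed_diff\<close> on generating
  functions, in the two orders of the variables. This makes the right side, up to sign, the
  generating function of an antisymmetrized mixed difference.\<close>

lemma two_rows_eq:
  "(u - v) * two_rows u v False False n F =
   (\<Sum>j<n. \<Sum>i<j. (u ^ j * v ^ i * (1 - v + u * v) - u ^ i * v ^ j * (1 - u + u * v)) * F (mark2 i j n))"
proof (induction n arbitrary: F)
  case (Suc n)
  let ?c = "\<lambda>i j. u ^ j * v ^ i * (1 - v + u * v) - u ^ i * v ^ j * (1 - u + u * v)"
  have c: "?c (Suc i) (Suc j) = u * v * ?c i j" for i j
    by (simp add: algebra_simps)
  have "(u - v) * two_rows u v False False (Suc n) F =
    u * v * ((u - v) * two_rows u v False False n (\<lambda>t. F (False # t))) +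
    (u - v) * (u * two_rows u v False True n (\<lambda>t. F (True # t)) + two_rows u v True False n (\<lambda>t. F (True # t)))"
    unfolding two_rows_simps by (simp only: algebra_simps)
  also have "\<dots> = (\<Sum>j<n. \<Sum>i<j. ?c (Suc i) (Suc j) * F (False # mark2 i j n)) +
    (\<Sum>j<n. ?c 0 (Suc j) * F (True # mark1 j n))"
    unfolding Suc.IH two_rows_mixed c sum_distrib_left by (simp add: mult.assoc)
  also have "\<dots> = (\<Sum>j<Suc n. \<Sum>i<j. ?c i j * F (mark2 i j (Suc n)))"
    unfolding sum.lessThan_Suc_shift mark2_simps by (simp add: sum.distrib add.commute)
  finally show ?case .
qed simp

section \<open>Monotone triangles as states of the model\<close>

fun interlace :: "int list \<Rightarrow> int list \<Rightarrow> bool" where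
  "interlace [k] [] \<longleftrightarrow> True"
| "interlace (k # k' # ks) (l # ls) \<longleftrightarrow> k \<le> l \<and> l \<le> k' \<and> interlace (k' # ks) ls"
| "interlace _ _ \<longleftrightarrow> False"

lemma interlace_iff_nth:
  "interlace ks ls \<longleftrightarrow>
   length ks = Suc (length ls) \<and> (\<forall>j<length ls. ks ! j \<le> ls ! j \<and> ls ! j \<le> ks ! Suc j)"
  by (induction ks ls rule: interlace.induct) (auto simp: All_less_Suc2)

lemma bottom_row_eq_iff:
  "bottom_row n t = ks \<longleftrightarrow> length ks = n \<and> (\<forall>j<n. t (n, Suc j) = ks ! j)"
  by (auto simp: bottom_row_def list_eq_iff_nth_eq simp del: upt_Suc)

lemma monotone_triangle_Suc:
  "monotone_triangle (Suc m) t \<longleftrightarrow>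
   t \<in> extensional (triangle_index (Suc m)) \<and> monotone_triangle m (restrict t (triangle_index m)) \<and>
   (\<forall>j<m. t (Suc m, Suc j) < t (Suc m, Suc (Suc j)) \<and>
      t (Suc m, Suc j) \<le> t (m, Suc j) \<and> t (m, Suc j) \<le> t (Suc m, Suc (Suc j)))"
  (is "?L \<longleftrightarrow> ?e \<and> ?M \<and> ?R")
proof -
  define C where "C i j \<longleftrightarrow> t (i, j) < t (i, j+1) \<and> t (i, j) \<le> t (i-1, j) \<and> t (i-1, j) \<le> t (i, j+1)" for i j
  have M: "?M \<longleftrightarrow> (\<forall>i\<in>{2..m}. \<forall>j\<in>{1..i-1}. C i j)"
  proof -
    define r where "r = restrict t (triangle_index m)"
    have "(\<forall>i\<in>{2..m}. \<forall>j\<in>{1..i-1}. r (i, j) < r (i, j+1) \<and> r (i, j) \<le> r (i-1, j) \<and> r (i-1, j) \<le> r (i, j+1)) \<longleftrightarrow>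
      (\<forall>i\<in>{2..m}. \<forall>j\<in>{1..i-1}. C i j)"
      by (intro ball_cong refl) (auto simp: triangle_index_def C_def r_def)
    then show ?thesis
      unfolding monotone_triangle_def r_def[symmetric] by (simp add: r_def)
  qed
  have R: "?R \<longleftrightarrow> (\<forall>j\<in>{1..m}. C (Suc m) j)"
    unfolding C_def image_Suc_lessThan[symmetric] by auto
  have L: "?L \<longleftrightarrow> ?e \<and> (\<forall>i\<in>{2..Suc m}. \<forall>j\<in>{1..i-1}. C i j)"
    unfolding monotone_triangle_def C_def by simp
  have "(\<forall>i\<in>{2..Suc m}. \<forall>j\<in>{1..i-1}. C i j) \<longleftrightarrow>
    (\<forall>i\<in>{2..m}. \<forall>j\<in>{1..i-1}. C i j) \<and> (\<forall>j\<in>{1..m}. C (Suc m) j)"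
    by (cases "m = 0") (auto simp: atLeastAtMostSuc_conv)
  then show ?thesis unfolding L M R by blast
qed

lemma monotone_triangle_bottom_sorted:
  assumes "monotone_triangle n t" "bottom_row n t = ks"
  shows "sorted_wrt (<) ks"
proof -
  have "ks ! j < ks ! Suc j" if "Suc j < length ks" for j
  proof -
    have n: "length ks = n" and nth: "\<And>j. j < n \<Longrightarrow> t (n, Suc j) = ks ! j"
      using assms(2) by (auto simp: bottom_row_eq_iff)
    have "n \<in> {2..n}" "Suc j \<in> {1..n-1}" using that n by auto
    then have "t (n, Suc j) < t (n, Suc j + 1)"
      using assms(1) unfolding monotone_triangle_def by blast
    then show ?thesis using nth that n by simp
  qed
  then show ?thesis by (simp add: sorted_wrt_iff_nth_Suc_transp)
qed

definition interlacers :: "int list \<Rightarrow> int list set" where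
  "interlacers ks = {ls. interlace ks ls \<and> sorted_wrt (<) ls}"

lemma finite_interlacers: "finite (interlacers ks)"
proof (rule finite_subset)
  show "interlacers ks \<subseteq> {ls. set ls \<subseteq> {Min (set ks)..Max (set ks)} \<and> length ls \<le> length ks}"
  proof safe
    fix ls assume "ls \<in> interlacers ks"
    then have *: "length ks = Suc (length ls)" "\<forall>j<length ls. ks ! j \<le> ls ! j \<and> ls ! j \<le> ks ! Suc j"
      by (auto simp: interlacers_def interlace_iff_nth)
    then show "length ls \<le> length ks" by simp
    fix x assume "x \<in> set ls"
    then obtain j where j: "j < length ls" "x = ls ! j" by (auto simp: in_set_conv_nth)
    then have "Min (set ks) \<le> ks ! j" "ks ! Suc j \<le> Max (set ks)" using *(1) by auto
    then show "x \<in> {Min (set ks)..Max (set ks)}" using j *(2) by (auto intro: order.trans)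
  qed
qed (simp add: finite_lists_length_le)

text \<open>Deleting the bottom row is a bijection onto pairs of an interlacing row and a triangle
  ending in it. The strict order of \<open>ks\<close> supplies the strict inequalities when the row
  is put back.\<close>

lemma \<alpha>_recursion:
  assumes "sorted_wrt (<) ks" "ks \<noteq> []"
  shows "\<alpha> ks = (\<Sum>ls\<in>interlacers ks. \<alpha> ls)"
proof -
  obtain m where m: "length ks = Suc m" using assms(2) by (cases ks) auto
  define f where "f t = (bottom_row m t, restrict t (triangle_index m))" for t :: "nat \<times> nat \<Rightarrow> int"
  define g where "g = (\<lambda>(ls :: int list, t :: nat \<times> nat \<Rightarrow> int).
     restrict (\<lambda>(i, j). if i = Suc m then ks ! (j - 1) else t (i, j)) (triangle_index (Suc m)))"
  let ?S = "Sigma (interlacers ks) monotone_triangles"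
  have row: "bottom_row m (restrict t (triangle_index m)) = bottom_row m t" for t
    by (auto simp: bottom_row_def triangle_index_def)
  have "bij_betw f (monotone_triangles ks) ?S"
  proof (rule bij_betw_byWitness[where f' = g])
    show "\<forall>t\<in>monotone_triangles ks. g (f t) = t"
    proof
      fix t assume t: "t \<in> monotone_triangles ks"
      then have ext: "t \<in> extensional (triangle_index (Suc m))"
        and bot: "\<forall>j<Suc m. t (Suc m, Suc j) = ks ! j"
        using m by (auto simp: monotone_triangles_def monotone_triangle_def bottom_row_eq_iff)
      show "g (f t) = t"
      proof (rule extensionalityI[OF _ ext])
        show "g (f t) \<in> extensional (triangle_index (Suc m))" by (simp add: g_def f_def)
        fix p assume p: "p \<in> triangle_index (Suc m)"
        obtain i j where ij: "p = (i, j)" by (cases p)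
        show "g (f t) p = t p"
          using p bot[rule_format, of "j - 1"] by (auto simp: g_def f_def ij triangle_index_def)
      qed
    qed
    show "\<forall>p\<in>?S. f (g p) = p"
    proof
      fix p assume "p \<in> ?S"
      then obtain ls t where p: "p = (ls, t)"
        and ls: "ls \<in> interlacers ks" "t \<in> monotone_triangles ls" by auto
      then have len: "length ls = m"
        using m by (auto simp: interlacers_def interlace_iff_nth)
      then have ext: "t \<in> extensional (triangle_index m)"
        and bot: "bottom_row m t = ls"
        using ls(2) by (auto simp: monotone_triangles_def monotone_triangle_def)
      have res: "restrict (g (ls, t)) (triangle_index m) = t"
        by (rule extensionalityI[OF _ ext]) (auto simp: g_def triangle_index_def)
      then have "bottom_row m (g (ls, t)) = ls" using row[of "g (ls, t)"] bot by simp
      then show "f (g p) = p" unfolding p using res by (simp add: f_def)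
    qed
    show "f ` monotone_triangles ks \<subseteq> ?S"
    proof (rule image_subsetI)
      fix t assume "t \<in> monotone_triangles ks"
      then have mt: "monotone_triangle (Suc m) t" and bot: "\<forall>j<Suc m. t (Suc m, Suc j) = ks ! j"
        using m by (auto simp: monotone_triangles_def bottom_row_eq_iff)
      define ls where "ls = bottom_row m t"
      have ls: "length ls = m" "\<forall>j<m. t (m, Suc j) = ls ! j"
        using ls_def by (metis bottom_row_eq_iff)+
      have mt': "monotone_triangle m (restrict t (triangle_index m))"
        using mt by (simp add: monotone_triangle_Suc)
      moreover have bot': "bottom_row m (restrict t (triangle_index m)) = ls"
        by (simp add: row ls_def)
      moreover have "interlace ks ls"
        using mt bot ls m unfolding monotone_triangle_Suc interlace_iff_nth by auto
      moreover have "sorted_wrt (<) ls"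
        by (rule monotone_triangle_bottom_sorted[OF mt' bot'])
      ultimately show "f t \<in> ?S"
        using ls by (simp add: f_def ls_def[symmetric] interlacers_def monotone_triangles_def)
    qed
    show "g ` ?S \<subseteq> monotone_triangles ks"
    proof (rule image_subsetI)
      fix p assume "p \<in> ?S"
      then obtain ls t where p: "p = (ls, t)"
        and ls: "ls \<in> interlacers ks" "t \<in> monotone_triangles ls" by auto
      then have il: "length ls = m" "\<forall>j<m. ks ! j \<le> ls ! j \<and> ls ! j \<le> ks ! Suc j"
        using m by (auto simp: interlacers_def interlace_iff_nth)
      then have mt: "monotone_triangle m t" and bot: "\<forall>j<m. t (m, Suc j) = ls ! j"
        using ls(2) by (auto simp: monotone_triangles_def bottom_row_eq_iff)
      have ext: "t \<in> extensional (triangle_index m)" using mt by (simp add: monotone_triangle_def)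
      have res: "restrict (g (ls, t)) (triangle_index m) = t"
        by (rule extensionalityI[OF _ ext]) (auto simp: g_def triangle_index_def)
      have top: "g (ls, t) (Suc m, Suc j) = ks ! j" if "j \<le> m" for j
        using that by (simp add: g_def triangle_index_def)
      have next_row: "g (ls, t) (m, Suc j) = ls ! j" if "j < m" for j
        using that bot by (simp add: g_def triangle_index_def)
      have inc: "ks ! j < ks ! Suc j" if "j < m" for j
        using assms(1) m that by (simp add: sorted_wrt_nth_less)
      have "monotone_triangle (Suc m) (g (ls, t))"
        unfolding monotone_triangle_Suc res using mt il(2) inc
        by (simp add: top next_row) (simp add: g_def)
      moreover have "bottom_row (Suc m) (g (ls, t)) = ks"
        unfolding bottom_row_eq_iff using m by (auto intro: top)
      ultimately show "g p \<in> monotone_triangles ks"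
        unfolding p using m by (simp add: monotone_triangles_def)
    qed
  qed
  then have "\<alpha> ks = card ?S" unfolding \<alpha>_def by (rule bij_betw_same_card)
  also have "\<dots> = (\<Sum>ls\<in>interlacers ks. \<alpha> ls)"
    unfolding \<alpha>_def by (rule card_SigmaI) (auto simp: finite_interlacers finite_monotone_triangles)
  finally show ?thesis .
qed

text \<open>A state \<open>s\<close> corresponds to the row of a monotone triangle that consists of the positions of \<open>False\<close>, counted from \<open>k\<close>.\<close>

fun gaps :: "int \<Rightarrow> bool list \<Rightarrow> int list" where
  "gaps k [] = []"
| "gaps k (b # s) = (if b then gaps (k + 1) s else k # gaps (k + 1) s)"

lemma set_gaps: "set (gaps k s) \<subseteq> {k..<k + int (length s)}"
  by (induction s arbitrary: k) (auto simp: subset_iff, fastforce+)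

lemma gaps_ge: "x \<in> set (gaps k s) \<Longrightarrow> k \<le> x"
  using set_gaps by fastforce

lemma gaps_gt: "x \<in> set (gaps (k + 1) s) \<Longrightarrow> k < x"
  using gaps_ge by fastforce

lemma sorted_gaps: "sorted_wrt (<) (gaps k s)"
  by (induction s arbitrary: k) (auto dest: gaps_gt)

lemma gaps_inj: "length s = length s' \<Longrightarrow> gaps k s = gaps k s' \<Longrightarrow> s = s'"
proof (induction s s' arbitrary: k rule: list_induct2)
  case (Cons b s b' s')
  have "k \<notin> set (gaps (k + 1) s)" "k \<notin> set (gaps (k + 1) s')" using gaps_gt by blast+
  then show ?case
    using Cons by (cases b; cases b') (auto, (metis list.set_intros(1))+)
qed simp

lemma gaps_surj:
  "sorted_wrt (<) ls \<Longrightarrow> set ls \<subseteq> {k..<k + int n} \<Longrightarrow> \<exists>s. length s = n \<and> gaps k s = ls"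
proof (induction n arbitrary: k ls)
  case (Suc n)
  show ?case
  proof (cases "k \<in> set ls")
    case True
    then obtain l ls' where ls: "ls = l # ls'" by (cases ls) auto
    with True Suc.prems have l: "l = k" by fastforce
    have "set ls' \<subseteq> {k + 1..<k + 1 + int n}" using Suc.prems by (fastforce simp: ls l)
    with Suc.IH[of ls' "k + 1"] Suc.prems obtain s where "length s = n" "gaps (k + 1) s = ls'"
      by (auto simp: ls)
    then show ?thesis by (intro exI[of _ "False # s"]) (simp add: ls l)
  next
    case False
    have "set ls \<subseteq> {k + 1..<k + 1 + int n}"
    proof
      fix x assume "x \<in> set ls"
      with False Suc.prems(2) show "x \<in> {k + 1..<k + 1 + int n}" by (cases "x = k") auto
    qed
    with Suc.IH[of ls "k + 1"] Suc.prems obtain s where "length s = n" "gaps (k + 1) s = ls"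
      by auto
    then show ?thesis by (intro exI[of _ "True # s"]) simp
  qed
qed simp

lemma gaps_eq_filter:
  "gaps k s = filter (\<lambda>x. \<not> s ! nat (x - k)) [k..k + int (length s) - 1]"
proof (induction s arbitrary: k)
  case (Cons b s)
  have "[k..k + int (length (b # s)) - 1] = k # [k + 1..k + 1 + int (length s) - 1]"
    by (subst upto_rec1) (auto simp: algebra_simps)
  moreover have "filter (\<lambda>x. \<not> (b # s) ! nat (x - k)) [k + 1..k + 1 + int (length s) - 1] =
    filter (\<lambda>x. \<not> s ! nat (x - (k + 1))) [k + 1..k + 1 + int (length s) - 1]"
  proof (rule filter_cong[OF refl])
    fix x assume "x \<in> set [k + 1..k + 1 + int (length s) - 1]"
    then have "nat (x - k) = Suc (nat (x - (k + 1)))" by auto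
    then show "(\<not> (b # s) ! nat (x - k)) = (\<not> s ! nat (x - (k + 1)))" by simp
  qed
  ultimately show ?case by (cases b) (simp_all add: Cons)
qed simp

text \<open>This lemma and the next four describe how one position \<open>k\<close> affects the
  interlacing condition. They mirror the vertices of \<open>transfer\<close>, including the two
  forbidden ones.\<close>

lemma interlace_same_head: "\<forall>x\<in>set ks. k \<le> x \<Longrightarrow> interlace (k # ks) (k # ls) \<longleftrightarrow> interlace ks ls"
  by (cases ks) auto

lemma interlace_pred_head: "\<forall>x\<in>set ks. k \<le> x \<Longrightarrow> interlace ((k - 1) # ks) (k # ls) \<longleftrightarrow> interlace ks ls"
  by (cases ks) auto

lemma interlace_small: "\<forall>x\<in>set ks. k < x \<Longrightarrow> \<not> interlace ks (k # ls)"
  by (cases ks; cases "tl ks") auto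

lemma interlace_large: "\<forall>x\<in>set ls. k < x \<Longrightarrow> \<not> interlace (k # k # ks) ls"
  by (cases ls) auto

lemma interlace_shift_head:
  "\<forall>x\<in>set ls. k < x \<Longrightarrow> interlace ((k - 1) # ks) ls \<longleftrightarrow> interlace (k # ks) ls"
  by (cases ls; cases ks) auto

lemma finite_bool_lists: "finite {s :: bool list. length s = n \<and> P s}"
  by (rule finite_subset[OF _ finite_lists_length_eq[of "UNIV :: bool set" n]]) auto

lemma sum_bool_lists_Suc:
  "(\<Sum>s | length s = Suc n \<and> P s. F s) =
   (\<Sum>s | length s = n \<and> P (False # s). F (False # s)) +
   (\<Sum>s | length s = n \<and> P (True # s). F (True # s))"
proof -
  let ?A = "\<lambda>b. {s. length s = n \<and> P (b # s)}"
  have "{s. length s = Suc n \<and> P s} = (#) False ` ?A False \<union> (#) True ` ?A True"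
  proof (intro equalityI subsetI)
    fix s assume "s \<in> {s. length s = Suc n \<and> P s}"
    then show "s \<in> (#) False ` ?A False \<union> (#) True ` ?A True"
      by (cases s; cases "hd s") auto
  qed auto
  then have "(\<Sum>s | length s = Suc n \<and> P s. F s) =
    sum F ((#) False ` ?A False) + sum F ((#) True ` ?A True)"
    using finite_bool_lists by (subst sum.union_disjoint[symmetric]) auto
  then show ?thesis by (simp add: sum.reindex)
qed

text \<open>A partial sum 1 means that one entry of the longer row is still waiting to be matched.
  It is recorded as \<open>k - 1\<close>, just before all remaining positions.\<close>

lemma transfer_ones:
  "length s = n \<Longrightarrow>
   transfer h (replicate n (1, 1, 1)) s F =
   (\<Sum>t | length t = n \<and> interlace ((if h then [k - 1] else []) @ gaps k s) (gaps k t). F t)"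
proof (induction s arbitrary: h k n F)
  case Nil
  have "{t. t = [] \<and> P t} = (if P [] then {[]} else {})" for P :: "bool list \<Rightarrow> bool" by auto
  with Nil show ?case by (cases h) simp_all
next
  case (Cons b s)
  then obtain m where n: "n = Suc m" "length s = m" by auto
  let ?G = "gaps (k + 1) s"
  have gt: "\<forall>x\<in>set (gaps (k + 1) t). k < x" and ge: "\<forall>x\<in>set (gaps (k + 1) t). k \<le> x" for t
    using gaps_gt[of _ k t] by (auto intro: less_imp_le)
  note IHF = Cons.IH[OF n(2), of False _ "k + 1", simplified]
  note IHT = Cons.IH[OF n(2), of True _ "k + 1", simplified]
  note il = interlace_same_head[OF ge] interlace_pred_head[OF ge] interlace_small[OF gt]
    interlace_large[OF gt] interlace_shift_head[OF gt]
  show ?case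
    unfolding n sum_bool_lists_Suc
    by (cases h; cases b) (simp_all add: IHF IHT il)
qed

lemma partition_fn_ones:
  "length (gaps 1 s) = m \<Longrightarrow> length s = n \<Longrightarrow>
   partition_fn (replicate m (replicate n (1, 1, 1))) s = (of_nat (\<alpha> (gaps 1 s)) :: 'a::comm_ring_1)"
proof (induction m arbitrary: s)
  case 0
  have "False \<notin> set s"
  proof
    have "False \<in> set s \<Longrightarrow> gaps k s \<noteq> []" for k by (induction s arbitrary: k) auto
    moreover assume "False \<in> set s"
    ultimately show False using 0 by blast
  qed
  then show ?case using 0 by (simp add: \<alpha>_Nil)
next
  case (Suc m)
  let ?S = "{t. length t = n \<and> interlace (gaps 1 s) (gaps 1 t)}"
  have bij: "bij_betw (gaps 1) ?S (interlacers (gaps 1 s))"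
  proof (rule bij_betw_imageI)
    show "inj_on (gaps 1) ?S" by (rule inj_onI) (auto intro: gaps_inj)
    show "gaps 1 ` ?S = interlacers (gaps 1 s)"
    proof (intro equalityI subsetI)
      fix ls assume "ls \<in> interlacers (gaps 1 s)"
      then have il: "interlace (gaps 1 s) ls" and so: "sorted_wrt (<) ls"
        by (auto simp: interlacers_def)
      \<comment> \<open>Interlacing keeps the entries between entries of \<open>gaps 1 s\<close>, so
        every interlacing row comes from a state of the same length.\<close>
      have "set ls \<subseteq> {1..<1 + int n}"
      proof
        fix x assume "x \<in> set ls"
        then obtain j where j: "j < length ls" "x = ls ! j" by (auto simp: in_set_conv_nth)
        then have "gaps 1 s ! j \<in> set (gaps 1 s)" "gaps 1 s ! Suc j \<in> set (gaps 1 s)"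
          "gaps 1 s ! j \<le> x" "x \<le> gaps 1 s ! Suc j"
          using il by (auto simp: interlace_iff_nth)
        then show "x \<in> {1..<1 + int n}" using set_gaps[of 1 s] Suc.prems(2) by fastforce
      qed
      from gaps_surj[OF so this] il show "ls \<in> gaps 1 ` ?S" by auto
    qed (auto simp: interlacers_def sorted_gaps)
  qed
  have "partition_fn (replicate (Suc m) (replicate n (1, 1, 1))) s =
    (\<Sum>t\<in>?S. partition_fn (replicate m (replicate n (1, 1, 1))) t :: 'a)"
    using transfer_ones[OF Suc.prems(2), of False _ 1] by simp
  also have "\<dots> = (\<Sum>t\<in>?S. of_nat (\<alpha> (gaps 1 t)))"
    using Suc by (intro sum.cong refl) (auto simp: interlace_iff_nth)
  also have "\<dots> = (\<Sum>ls\<in>interlacers (gaps 1 s). of_nat (\<alpha> ls))"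
    by (rule sum.reindex_bij_betw[OF bij])
  also have "\<dots> = of_nat (\<alpha> (gaps 1 s))"
    using \<alpha>_recursion[OF sorted_gaps, of 1 s] Suc.prems(1) by (simp flip: of_nat_sum) force
  finally show ?case .
qed

lemma gaps_mark1: "j < n \<Longrightarrow> gaps 1 (mark1 j n) = removeAll (int j + 1) [1..int n]"
  unfolding gaps_eq_filter removeAll_filter_not_eq
  by (auto simp: mark1_def intro!: filter_cong)

lemma gaps_mark2:
  "i < n \<Longrightarrow> j < n \<Longrightarrow>
   gaps 1 (mark2 i j n) = removeAll (int j + 1) (removeAll (int i + 1) [1..int n])"
  unfolding gaps_eq_filter removeAll_filter_not_eq filter_filter
  by (auto simp: mark2_def intro!: filter_cong)

section \<open>Solutions of the three-term relation\<close>

lemma poly_zero_cofinite: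
  fixes p :: "complex poly"
  assumes "finite S" "\<And>x. x \<notin> S \<Longrightarrow> poly p x = 0"
  shows "p = 0"
proof (rule ccontr)
  assume "p \<noteq> 0"
  then have "finite (S \<union> {x. poly p x = 0})" using assms(1) poly_roots_finite by blast
  moreover have "S \<union> {x. poly p x = 0} = UNIV" using assms(2) by auto
  ultimately show False using infinite_UNIV_char_0[where 'a = complex] by simp
qed

lemma power_sum_zero_cofinite:
  fixes a :: "nat \<Rightarrow> complex"
  assumes "finite S" "\<And>x. x \<notin> S \<Longrightarrow> (\<Sum>r\<le>N. a r * x ^ r) = 0" "r \<le> N"
  shows "a r = 0"
proof -
  have "(\<Sum>r\<le>N. monom (a r) r) = 0"
    by (rule poly_zero_cofinite[OF assms(1)]) (simp add: poly_sum poly_monom assms(2))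
  then have "coeff (\<Sum>r\<le>N. monom (a r) r) r = 0" by simp
  then show ?thesis using assms(3) by (simp add: coeff_sum)
qed

text \<open>The finite exceptional set \<open>S\<close> leaves room for the poles of the change of
  variables.\<close>

lemma tripled_zero_imp_coeff:
  fixes p :: "complex poly"
  assumes "finite S" "\<And>x. x \<notin> S \<Longrightarrow> tripled (poly p) x = 0"
  shows "coeff p (3 * k + 2) = 0"
proof -
  define N where "N = Suc (degree p + k)"
  have "\<forall>m\<ge>3 * N + 2. coeff p m = 0" by (auto simp: N_def intro!: coeff_eq_0)
  from poly_eq_sum_lessThan[OF this] have "poly p = (\<lambda>x. \<Sum>m<3 * N + 2. coeff p m * x ^ m)"
    by auto
  then have tr: "tripled (poly p) x = 3 * x ^ 2 * (\<Sum>k<N. coeff p (3 * k + 2) * (x ^ 3) ^ k)" for x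
    using tripled_power_sum by simp
  have "(\<Sum>k<N. monom (coeff p (3 * k + 2)) (3 * k + 2)) = 0"
  proof (rule poly_zero_cofinite[OF assms(1)])
    fix x assume "x \<notin> S"
    then have "x ^ 2 * (\<Sum>k<N. coeff p (3 * k + 2) * (x ^ 3) ^ k) = 0" using tr assms(2) by simp
    then show "poly (\<Sum>k<N. monom (coeff p (3 * k + 2)) (3 * k + 2)) x = 0"
      unfolding sum_distrib_left
      by (simp add: poly_sum poly_monom power_add power_mult[symmetric] power2_eq_square mult_ac)
  qed
  then have "coeff (\<Sum>k<N. monom (coeff p (3 * k + 2)) (3 * k + 2)) (3 * k + 2) = 0" by simp
  moreover have "k < N" by (simp add: N_def)
  ultimately show ?thesis by (simp add: coeff_sum)
qed

lemma finite_support: "finite {m. coeff p m \<noteq> 0}" for p :: "complex poly"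
  by (rule finite_subset[of _ "{..degree p}"]) (auto intro: le_degree)

lemma root_one_order_less_support:
  fixes p :: "complex poly"
  shows "p \<noteq> 0 \<Longrightarrow> [:-1, 1:] ^ k dvd p \<Longrightarrow> k < card {m. coeff p m \<noteq> 0}"
proof (induction k arbitrary: p)
  case 0
  then have "degree p \<in> {m. coeff p m \<noteq> 0}" by simp
  then show ?case using finite_support by (metis card_gt_0_iff empty_iff)
next
  case (Suc k)
  define j where "j = degree p"
  have j: "coeff p j \<noteq> 0" using Suc.prems(1) by (simp add: j_def)
  (* The coefficient of degree m is multiplied by m - j: one term vanishes, and the order at 1 drops by at most one. *)
  define q where "q = [:0, 1:] * pderiv p - smult (of_nat j) p"
  have coeff_q: "coeff q m = (of_nat m - of_nat j) * coeff p m" for m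
    by (cases m) (simp_all add: q_def coeff_pderiv algebra_simps)
  then have supp: "{m. coeff q m \<noteq> 0} = {m. coeff p m \<noteq> 0} - {j}" by auto
  obtain r where r: "p = [:-1, 1:] ^ Suc k * r" using Suc.prems(2) by blast
  have "pderiv p = [:-1, 1:] ^ k * ([:-1, 1:] * pderiv r + r * smult (of_nat (Suc k)) (pderiv [:-1, 1:]))"
    unfolding r pderiv_mult pderiv_power_Suc by (simp add: algebra_simps)
  then have "[:-1, 1:] ^ k dvd pderiv p" by (metis dvd_triv_left)
  moreover have "[:-1, 1:] ^ k dvd p" unfolding r power_Suc2 mult.assoc by (rule dvd_triv_left)
  ultimately have dvd: "[:-1, 1:] ^ k dvd q" unfolding q_def by (intro dvd_diff dvd_mult dvd_smult)
  have "q \<noteq> 0"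
  proof
    assume "q = 0"
    then have "coeff p m = 0" if "m \<noteq> j" for m using coeff_q[of m] that by auto
    then have "p = monom (coeff p j) j" by (auto intro!: poly_eqI)
    then have "poly p 1 = coeff p j" by (metis poly_monom power_one mult.right_neutral)
    moreover have "poly p 1 = 0" unfolding r by simp
    ultimately show False using j by simp
  qed
  from Suc.IH[OF this dvd] show ?case
    unfolding supp using j finite_support[of p] by (simp add: card_Diff_singleton)
qed

lemma pderiv_sum: "pderiv (\<Sum>i\<in>A. f i) = (\<Sum>i\<in>A. pderiv (f i))"
  by (induction A rule: infinite_finite_induct) (simp_all add: pderiv_add)

text \<open>\<open>num_poly\<close> and \<open>den_poly\<close> are the weights a and b of
  \<open>vertex x 1\<close> as polynomials in x; their quotient is the variable u.\<close>

definition num_poly :: "complex poly" where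
  "num_poly = [:- (2 + \<omega>) / 3 * \<omega>, (2 + \<omega>) / 3:]"

definition den_poly :: "complex poly" where
  "den_poly = [:(2 + \<omega>) / 3, - (2 + \<omega>) / 3 * \<omega>:]"

text \<open>The power u^s with its denominator cleared by the factor
  \<open>den_poly ^ n\<close>.\<close>

definition mobius_basis :: "nat \<Rightarrow> nat \<Rightarrow> complex poly" where
  "mobius_basis n s = num_poly ^ s * den_poly ^ (n - s)"

lemma poly_num_den_1: "poly num_poly 1 = 1" "poly den_poly 1 = 1"
proof -
  have k: "(2 + \<omega>) / 3 * (1 - \<omega>) = 1" by (simp add: field_simps omega_sq)
  have "poly num_poly 1 = (2 + \<omega>) / 3 * (1 - \<omega>)" "poly den_poly 1 = (2 + \<omega>) / 3 * (1 - \<omega>)"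
    by (simp_all add: num_poly_def den_poly_def field_simps)
  then show "poly num_poly 1 = 1" "poly den_poly 1 = 1" by (simp_all only: k)
qed

lemma pderiv_num_den: "pderiv num_poly = [:(2 + \<omega>) / 3:]" "pderiv den_poly = [:- (2 + \<omega>) / 3 * \<omega>:]"
  by (simp_all add: num_poly_def den_poly_def pderiv_pCons)

text \<open>The inverse of the change of variables from x to u; its pole is u = 1 +
  \<omega>.\<close>

definition mobius :: "complex \<Rightarrow> complex" where
  "mobius u = (u + \<omega>) / (1 + \<omega> * u)"

lemma one_plus_omega_neq: "1 + \<omega> * u \<noteq> 0 \<longleftrightarrow> u \<noteq> 1 + \<omega>"
proof -
  have "1 + \<omega> * u = \<omega> * (u - (1 + \<omega>))" by (simp add: algebra_simps omega_sq)
  moreover have "\<omega> \<noteq> 0" using omega_cube by auto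
  ultimately show ?thesis by auto
qed

lemma mobius_num_den:
  assumes "1 + \<omega> * u \<noteq> 0"
  shows "poly den_poly (mobius u) \<noteq> 0" "poly num_poly (mobius u) = u * poly den_poly (mobius u)"
proof -
  let ?m = "mobius u" and ?c = "1 + \<omega> * u"
  have m: "?m * ?c = u + \<omega>" using assms by (simp add: mobius_def)
  have "poly den_poly ?m * ?c = (2 + \<omega>) / 3 * (?c - \<omega> * (?m * ?c))"
    by (simp add: den_poly_def field_simps)
  also have "\<dots> = 1 + \<omega>"
    unfolding m by (simp add: field_simps omega_sq omega_mult_sq)
  finally have d: "poly den_poly ?m * ?c = 1 + \<omega>" .
  have "poly num_poly ?m * ?c = (2 + \<omega>) / 3 * (?m * ?c - \<omega> * ?c)"
    by (simp add: num_poly_def field_simps)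
  also have "\<dots> = u * (1 + \<omega>)"
    unfolding m by (simp add: field_simps omega_sq omega_mult_sq)
  finally have n: "poly num_poly ?m * ?c = u * (1 + \<omega>)" .
  have "1 + \<omega> \<noteq> 0" using one_plus_omega_neq[of 1] omega_sq by auto
  then show "poly den_poly ?m \<noteq> 0" using d by auto
  have "poly num_poly ?m * ?c = u * poly den_poly ?m * ?c"
    by (simp only: n mult.assoc d)
  then show "poly num_poly ?m = u * poly den_poly ?m" using assms by simp
qed

lemma card_not_2_mod_3: "card {m. m < 3 * n \<and> m mod 3 \<noteq> 2} \<le> 2 * n"
proof -
  have "{m. m < 3 * n \<and> m mod 3 \<noteq> 2} \<subseteq> (\<lambda>k. 3 * k) ` {..<n} \<union> (\<lambda>k. 3 * k + 1) ` {..<n}"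
  proof
    fix m :: nat assume m: "m \<in> {m. m < 3 * n \<and> m mod 3 \<noteq> 2}"
    then have "m = 3 * (m div 3) \<or> m = 3 * (m div 3) + 1" "m div 3 < n" by auto presburger
    then show "m \<in> (\<lambda>k. 3 * k) ` {..<n} \<union> (\<lambda>k. 3 * k + 1) ` {..<n}" by blast
  qed
  then have "card {m. m < 3 * n \<and> m mod 3 \<noteq> 2} \<le> card ((\<lambda>k. 3 * k) ` {..<n} \<union> (\<lambda>k. 3 * k + 1) ` {..<n})"
    by (rule card_mono[rotated]) simp
  also have "\<dots> \<le> card ((\<lambda>k. 3 * k) ` {..<n}) + card ((\<lambda>k. 3 * k + 1) ` {..<n})"
    by (rule card_Un_le)
  also have "\<dots> \<le> n + n"
    by (intro add_mono order.trans[OF card_image_le]) auto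
  finally show ?thesis by simp
qed

text \<open>The first sum in \<open>jet\<close> is the value of the combination at 1, and the two
  sums together determine its derivative there. If both vanish, the full product has a zero of order
  2n at 1, while its degree is below 3n and its exponents avoid 2 modulo 3.\<close>

lemma mobius_combination_unique:
  assumes n: "n \<ge> 1"
    and three: "\<And>k. coeff ([:-1, 1:] ^ (2 * n - 2) * (\<Sum>s\<le>n. smult (d s) (mobius_basis n s))) (3 * k + 2) = 0"
    and jet: "(\<Sum>s\<le>n. d s) = 0" "(\<Sum>s\<le>n. of_nat s * d s) = 0"
    and s: "s \<le> n"
  shows "d s = 0"
proof -
  define p where "p = (\<Sum>s\<le>n. smult (d s) (mobius_basis n s))"
  let ?f = "[:-1, 1:] ^ (2 * n - 2) * p"
  have p1: "poly p 1 = 0"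
    using jet(1) by (simp add: p_def poly_sum mobius_basis_def poly_num_den_1)
  have "poly (pderiv (mobius_basis n s)) 1 =
    of_nat s * ((2 + \<omega>) / 3 * (1 + \<omega>)) - of_nat n * ((2 + \<omega>) / 3 * \<omega>)" if "s \<le> n" for s
    unfolding mobius_basis_def using that
    by (simp add: pderiv_mult pderiv_power pderiv_num_den poly_num_den_1 of_nat_diff) (simp add: field_simps)
  then have "poly (pderiv p) 1 =
    (\<Sum>s\<le>n. d s * (of_nat s * ((2 + \<omega>) / 3 * (1 + \<omega>)) - of_nat n * ((2 + \<omega>) / 3 * \<omega>)))"
    by (simp add: p_def pderiv_sum pderiv_smult poly_sum)
  also have "\<dots> = (2 + \<omega>) / 3 * (1 + \<omega>) * (\<Sum>s\<le>n. of_nat s * d s) -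
      of_nat n * ((2 + \<omega>) / 3 * \<omega>) * (\<Sum>s\<le>n. d s)"
    unfolding sum_distrib_left sum_subtractf[symmetric]
    by (rule sum.cong) (simp_all add: algebra_simps)
  finally have dp1: "poly (pderiv p) 1 = 0" using jet by simp
  obtain q where q: "p = [:-1, 1:] * q" using p1 unfolding poly_eq_0_iff_dvd by blast
  then have "poly q 1 = 0" using dp1 by (simp add: pderiv_mult pderiv_pCons del: mult_pCons_left)
  then obtain r where r: "q = [:-1, 1:] * r" unfolding poly_eq_0_iff_dvd by blast
  have "2 * n = 2 * n - 2 + 2" using n by simp
  then have "?f = [:-1, 1:] ^ (2 * n) * r"
    by (metis q r power_add power2_eq_square mult.assoc)
  then have dvd: "[:-1, 1:] ^ (2 * n) dvd ?f" by (metis dvd_triv_left)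
  have degb: "degree (mobius_basis n s) \<le> n" if "s \<le> n" for s
  proof -
    have "degree (mobius_basis n s) \<le> degree (num_poly ^ s) + degree (den_poly ^ (n - s))"
      unfolding mobius_basis_def by (rule degree_mult_le)
    also have "\<dots> \<le> degree num_poly * s + degree den_poly * (n - s)"
      by (intro add_mono degree_power_le)
    also have "\<dots> \<le> 1 * s + 1 * (n - s)"
      by (intro add_mono mult_right_mono) (simp_all add: num_poly_def den_poly_def)
    finally show ?thesis using that by simp
  qed
  have "degree p \<le> n"
    unfolding p_def by (rule degree_sum_le) (auto intro: order.trans[OF degree_smult_le] degb)
  moreover have "degree ([:-1, 1:] ^ (2 * n - 2) :: complex poly) \<le> 2 * n - 2"
    by (simp add: degree_power_eq)
  ultimately have deg: "degree ?f < 3 * n"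
    using degree_mult_le[of "[:-1, 1:] ^ (2 * n - 2)" p] n by linarith
  have "?f = 0"
  proof (rule ccontr)
    assume "?f \<noteq> 0"
    from root_one_order_less_support[OF this dvd] have "2 * n < card {m. coeff ?f m \<noteq> 0}" .
    also have "\<dots> \<le> card {m. m < 3 * n \<and> m mod 3 \<noteq> 2}"
    proof (rule card_mono)
      show "{m. coeff ?f m \<noteq> 0} \<subseteq> {m. m < 3 * n \<and> m mod 3 \<noteq> 2}"
      proof safe
        fix m assume m: "coeff ?f m \<noteq> 0"
        show "m < 3 * n" using le_degree[OF m] deg by linarith
        assume "m mod 3 = 2"
        then have "m = 3 * (m div 3) + 2" by presburger
        then show False using three[of "m div 3"] m by (simp add: p_def)
      qed
    qed simp
    finally show False using card_not_2_mod_3[of n] by simp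
  qed
  then have p0: "p = 0" by simp
  \<comment> \<open>Evaluation at \<open>mobius u\<close> returns from the polynomials in x to the
    powers of u, whose coefficients can be read off.\<close>
  have "(\<Sum>s\<le>n. d s * u ^ s) = 0" if "u \<notin> {1 + \<omega>}" for u
  proof -
    let ?b = "poly den_poly (mobius u)"
    have u: "?b \<noteq> 0" "poly num_poly (mobius u) = u * ?b"
      using mobius_num_den[of u] one_plus_omega_neq[of u] that by auto
    have "(\<Sum>s\<le>n. d s * u ^ s) * ?b ^ n = (\<Sum>s\<le>n. d s * poly (mobius_basis n s) (mobius u))"
      unfolding sum_distrib_right
    proof (rule sum.cong[OF refl])
      fix s assume "s \<in> {..n}"
      then have "?b ^ n = ?b ^ s * ?b ^ (n - s)" by (simp flip: power_add)
      then show "d s * u ^ s * ?b ^ n = d s * poly (mobius_basis n s) (mobius u)"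
        by (simp add: mobius_basis_def u(2) power_mult_distrib)
    qed
    also have "\<dots> = poly p (mobius u)" by (simp add: p_def poly_sum)
    finally show ?thesis using u(1) p0 by simp
  qed
  then show ?thesis using power_sum_zero_cofinite[of "{1 + \<omega>}" d n s] s by simp
qed

text \<open>For column parameter 1 the weight of -1 is x = a^2 - a b + b^2, so after extracting b
  only u = a / b remains.\<close>

lemma vertex_rescale:
  assumes "poly den_poly x \<noteq> 0"
  shows "vertex x 1 = rescale (poly den_poly x) (hom_weights (poly num_poly x / poly den_poly x))"
proof -
  let ?a = "poly num_poly x" and ?b = "poly den_poly x"
  have "?a ^ 2 - ?a * ?b + ?b ^ 2 = x"
    by (simp add: num_poly_def den_poly_def power2_eq_square field_simps omega_sq omega_mult_sq)
  then have "?b ^ 2 * ((?a / ?b) ^ 2 - ?a / ?b + 1) = x"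
    using assms by (simp add: power2_eq_square field_simps)
  moreover have "wa (vertex x 1) = ?a" "wb (vertex x 1) = ?b"
    by (simp_all add: vertex_def num_poly_def den_poly_def field_simps)
  ultimately show ?thesis
    using assms by (simp add: rescale_def hom_weights_simps prod_eq_iff) (simp add: vertex_def)
qed

text \<open>Converts the factor x - t of \<open>scaled_dwbc\<close> into u - v times both
  denominators.\<close>

lemma num_den_cross:
  "poly num_poly x * poly den_poly t - poly num_poly t * poly den_poly x =
   (2 + \<omega>) / 3 * (1 + \<omega>) * (x - t)"
  by (simp add: num_poly_def den_poly_def field_simps omega_sq omega_mult_sq)

lemma lattice_ones: "lattice (replicate m 1) (replicate n 1) = replicate m (replicate n (1, 1, 1))"
proof -
  have "vertex 1 1 = (1, 1, 1)" by (simp add: vertex_def field_simps omega_sq)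
  then show ?thesis by (simp add: lattice_def)
qed

lemma dwbc_two_rows:
  assumes "poly den_poly x \<noteq> 0" "poly den_poly t \<noteq> 0"
  shows "poly den_poly x * poly den_poly t * dwbc (x # t # replicate m 1) (replicate n 1) =
    poly den_poly x ^ n * poly den_poly t ^ n *
    two_rows (poly num_poly x / poly den_poly x) (poly num_poly t / poly den_poly t) False False n
      (partition_fn (replicate m (replicate n (1, 1, 1))))"
proof -
  let ?u = "\<lambda>x. poly num_poly x / poly den_poly x"
  let ?F = "partition_fn (replicate m (replicate n (1, 1, 1)))"
  have row: "map (vertex x) (replicate n 1) = map (rescale (poly den_poly x)) (replicate n (hom_weights (?u x)))"
    if "poly den_poly x \<noteq> 0" for x
    using vertex_rescale[OF that] by simp
  have "poly den_poly t * dwbc (x # t # replicate m 1) (replicate n 1) =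
    transfer False (map (vertex x) (replicate n 1)) (replicate n False)
      (\<lambda>s. poly den_poly t * transfer False (map (vertex t) (replicate n 1)) s ?F)"
    unfolding dwbc_def lattice_simps partition_fn.simps lattice_ones length_replicate
    by (rule transfer_scale[symmetric]) simp
  also have "\<dots> = transfer False (map (vertex x) (replicate n 1)) (replicate n False)
      (\<lambda>s. poly den_poly t ^ n * transfer False (replicate n (hom_weights (?u t))) s ?F)"
  proof (rule transfer_cong)
    fix s :: "bool list" assume "length s = length (replicate n False)"
    then show "poly den_poly t * transfer False (map (vertex t) (replicate n 1)) s ?F =
      poly den_poly t ^ n * transfer False (replicate n (hom_weights (?u t))) s ?F"
      unfolding row[OF assms(2)] using transfer_rescale[of "replicate n (hom_weights (?u t))" s] by simp
  qed simp
  also have "\<dots> = poly den_poly t ^ n * transfer False (map (vertex x) (replicate n 1)) (replicate n False)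
      (\<lambda>s. transfer False (replicate n (hom_weights (?u t))) s ?F)"
    by (rule transfer_scale) simp
  finally have "poly den_poly x * (poly den_poly t * dwbc (x # t # replicate m 1) (replicate n 1)) =
    poly den_poly t ^ n * (poly den_poly x * transfer False (map (vertex x) (replicate n 1)) (replicate n False)
      (\<lambda>s. transfer False (replicate n (hom_weights (?u t))) s ?F))"
    by (simp only: mult_ac)
  also have "poly den_poly x * transfer False (map (vertex x) (replicate n 1)) (replicate n False)
      (\<lambda>s. transfer False (replicate n (hom_weights (?u t))) s ?F) =
    poly den_poly x ^ n * two_rows (?u x) (?u t) False False n ?F"
    unfolding row[OF assms(1)]
    using transfer_rescale[of "replicate n (hom_weights (?u x))" "replicate n False"] by simp
  finally show ?thesis by (simp only: mult_ac)
qed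

lemma coeff_mult_mobius_sum:
  "coeff (p * (\<Sum>s\<le>n. smult (d s) (mobius_basis n s))) m = (\<Sum>s\<le>n. d s * coeff (p * mobius_basis n s) m)"
  by (simp add: sum_distrib_left coeff_sum)

text \<open>For fixed v the polynomial \<open>h v\<close> is a constant multiple of
  \<open>scaled_dwbc\<close> with row parameters \<open>mobius v\<close> and 1. The three-term
  relation removes its exponents 2 modulo 3, and comparing powers of v separates the columns of
  \<open>w\<close>.\<close>

lemma two_rows_columns:
  assumes n: "n \<ge> 2"
    and w: "\<And>u v. (\<Sum>s\<le>n. \<Sum>t\<le>n. w s t * u ^ s * v ^ t) =
      (v - u) * two_rows u v False False n (partition_fn (replicate (n - 2) (replicate n (1, 1, 1))))"
    and r: "r \<le> n"
  shows "coeff ([:-1, 1:] ^ (2 * n - 2) * (\<Sum>s\<le>n. smult (w s r) (mobius_basis n s))) (3 * k + 2) = 0"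
proof -
  let ?F = "partition_fn (replicate (n - 2) (replicate n (1, 1, 1)))"
  define f where "f r = [:-1, 1:] ^ (2 * n - 2) * (\<Sum>s\<le>n. smult (w s r) (mobius_basis n s))" for r
  define h where "h v = (\<Sum>r\<le>n. smult (v ^ r) (f r))" for v
  let ?K = "(2 + \<omega>) / 3 * (1 + \<omega>)"
  have "coeff (h v) (3 * k + 2) = 0" if v: "v \<notin> {1 + \<omega>}" for v
  proof -
    define t where "t = mobius v"
    define xs where "xs = t # replicate (n - 2) 1"
    have t: "poly den_poly t \<noteq> 0" "poly num_poly t = v * poly den_poly t"
      using mobius_num_den[of v] one_plus_omega_neq[of v] v by (auto simp: t_def)
    have len: "length xs = n - 1" "replicate (Suc (n - 1)) (1::complex) = replicate n 1"
      using n by (simp_all add: xs_def)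
    have scaled: "- ?K * scaled_dwbc xs (replicate n 1) x = poly den_poly t ^ n * poly (h v) x"
      if x: "poly den_poly x \<noteq> 0" for x
    proof -
      let ?bx = "poly den_poly x" and ?bt = "poly den_poly t"
      let ?u = "poly num_poly x / poly den_poly x"
      let ?T = "two_rows ?u v False False n ?F"
      have cross: "?K * (x - t) = ?bx * ?bt * (?u - v)"
      proof -
        have "?bx * ?bt * (?u - v) = poly num_poly x * ?bt - poly num_poly t * ?bx"
          using x by (simp add: t(2) right_diff_distrib mult_ac)
        then show ?thesis by (simp only: num_den_cross)
      qed
      have tr: "?bx * ?bt * dwbc (x # xs) (replicate n 1) = ?bx ^ n * ?bt ^ n * ?T"
        using dwbc_two_rows[OF x t(1), of "n - 2" n] t by (simp add: xs_def)
      have pow: "(\<Prod>y\<leftarrow>xs. x - y) * (\<Prod>y\<leftarrow>replicate n 1. x - y) = (x - t) * (x - 1) ^ (2 * n - 2)"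
      proof -
        have "2 * n - 2 = (n - 2) + n" using n by simp
        then show ?thesis by (simp add: xs_def prod_list_replicate power_add)
      qed
      have "- ?K * scaled_dwbc xs (replicate n 1) x =
        - ((x - 1) ^ (2 * n - 2)) * (?K * (x - t)) * dwbc (x # xs) (replicate n 1)"
        unfolding scaled_dwbc_def pow by (simp only: mult_ac mult_minus_left mult_minus_right)
      also have "\<dots> = (x - 1) ^ (2 * n - 2) * (v - ?u) * (?bx * ?bt * dwbc (x # xs) (replicate n 1))"
        unfolding cross by (simp add: algebra_simps)
      also have "\<dots> = (x - 1) ^ (2 * n - 2) * ?bt ^ n * (?bx ^ n * ((v - ?u) * ?T))"
        unfolding tr by (simp only: mult_ac)
      also have "?bx ^ n * ((v - ?u) * ?T) = (\<Sum>s\<le>n. \<Sum>r\<le>n. v ^ r * (w s r * poly (mobius_basis n s) x))"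
        unfolding w[symmetric] sum_distrib_left
      proof (intro sum.cong refl)
        fix s r assume "s \<in> {..n}"
        then have b: "?bx ^ n = ?bx ^ s * ?bx ^ (n - s)" by (simp flip: power_add)
        show "?bx ^ n * (w s r * ?u ^ s * v ^ r) = v ^ r * (w s r * poly (mobius_basis n s) x)"
          unfolding b mobius_basis_def using x by (simp add: power_divide)
      qed
      also have "\<dots> = (\<Sum>r\<le>n. \<Sum>s\<le>n. v ^ r * (w s r * poly (mobius_basis n s) x))"
        by (rule sum.swap)
      also have "(x - 1) ^ (2 * n - 2) * ?bt ^ n * \<dots> = ?bt ^ n * poly (h v) x"
        by (simp add: h_def f_def poly_sum sum_distrib_left sum_distrib_right mult_ac)
      finally show ?thesis .
    qed
    \<comment> \<open>The only zero of \<open>den_poly\<close> is \<omega>^2; the excluded x are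
      those for which x, \<omega> x or \<omega>^2 x equals it.\<close>
    have "tripled (poly (h v)) x = 0" if x: "x \<notin> {1, \<omega>, \<omega>\<^sup>2}" for x
    proof -
      have den: "poly den_poly z \<noteq> 0" if "z \<noteq> \<omega>\<^sup>2" for z
      proof
        assume "poly den_poly z = 0"
        then have "0 = \<omega>\<^sup>2 * ((1 - \<omega>) * poly den_poly z)" by simp
        also have "\<dots> = \<omega>\<^sup>2 - z"
          by (simp add: den_poly_def power2_eq_square field_simps omega_sq omega_mult_sq)
        finally show False using that by simp
      qed
      have "\<omega> \<noteq> 0" using omega_cube by auto
      then have "\<omega> * x \<noteq> \<omega>\<^sup>2" "\<omega>\<^sup>2 * x \<noteq> \<omega>\<^sup>2" using x by (auto simp: power2_eq_square)
      then have "poly den_poly t ^ n * tripled (poly (h v)) x = - ?K * tripled (scaled_dwbc xs (replicate n 1)) x"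
        using scaled[OF den] x unfolding tripled_def by (simp add: distrib_left mult.left_commute)
      then show ?thesis using tripled_scaled_dwbc[OF len(1), of x, unfolded len(2)] t(1) by simp
    qed
    then show ?thesis using tripled_zero_imp_coeff[of "{1, \<omega>, \<omega>\<^sup>2}" "h v" k] by simp
  qed
  then have "(\<Sum>r\<le>n. coeff (f r) (3 * k + 2) * v ^ r) = 0" if "v \<notin> {1 + \<omega>}" for v
    using that by (simp add: h_def coeff_sum mult.commute)
  then have "coeff (f r) (3 * k + 2) = 0"
    using power_sum_zero_cofinite[of "{1 + \<omega>}" "\<lambda>r. coeff (f r) (3 * k + 2)" n r] r by simp
  then show ?thesis by (simp add: f_def)
qed

section \<open>Rank two and the formula\<close>

text \<open>\<open>P\<close> and \<open>Q\<close> are combinations of the columns of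
  \<open>w\<close>, and so is the difference \<open>d\<close> of the two sides. By antisymmetry both
  jets of \<open>d\<close> vanish, so \<open>d\<close> is 0 by uniqueness.\<close>

lemma wedge_formula:
  fixes w :: "nat \<Rightarrow> nat \<Rightarrow> complex" and n :: nat
  defines "P \<equiv> \<lambda>s. \<Sum>t\<le>n. w s t" and "Q \<equiv> \<lambda>s. \<Sum>t\<le>n. of_nat t * w s t"
  assumes n: "n \<ge> 1"
    and anti: "\<And>s t. w t s = - w s t"
    and cols: "\<And>r k. r \<le> n \<Longrightarrow>
      coeff ([:-1, 1:] ^ (2 * n - 2) * (\<Sum>s\<le>n. smult (w s r) (mobius_basis n s))) (3 * k + 2) = 0"
    and rs: "r \<le> n" "s \<le> n"
  shows "(\<Sum>s\<le>n. Q s) * w s r = Q r * P s - P r * Q s"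
proof -
  define c where "c = (\<Sum>s\<le>n. Q s)"
  define d where "d s = c * w s r - Q r * P s + P r * Q s" for s
  have anti_zero: "x = 0" if "x = - x" for x :: complex using that by (simp add: eq_neg_iff_add_eq_0)
  have sum_anti: "(\<Sum>s\<le>n. \<Sum>t\<le>n. e s * e t * w s t) = 0" for e
  proof (rule anti_zero)
    have "(\<Sum>s\<le>n. \<Sum>t\<le>n. e s * e t * w s t) = (\<Sum>t\<le>n. \<Sum>s\<le>n. e s * e t * w s t)" by (rule sum.swap)
    also have "\<dots> = (\<Sum>t\<le>n. \<Sum>s\<le>n. - (e t * e s * w t s))"
      by (intro sum.cong refl, subst anti) (simp add: mult_ac)
    finally show "(\<Sum>s\<le>n. \<Sum>t\<le>n. e s * e t * w s t) = - (\<Sum>s\<le>n. \<Sum>t\<le>n. e s * e t * w s t)"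
      by (simp add: sum_negf)
  qed
  have P0: "(\<Sum>s\<le>n. P s) = 0" using sum_anti[of "\<lambda>_. 1"] by (simp add: P_def)
  have sQ: "(\<Sum>s\<le>n. of_nat s * Q s) = 0"
    using sum_anti[of of_nat] by (simp add: Q_def sum_distrib_left mult_ac)
  have wr: "(\<Sum>s\<le>n. w s r) = - P r" and swr: "(\<Sum>s\<le>n. of_nat s * w s r) = - Q r"
    unfolding P_def Q_def sum_negf[symmetric] mult_minus_right[symmetric]
    by (intro sum.cong refl, subst anti, rule refl)+
  have "(\<Sum>s\<le>n. of_nat s * P s) = (\<Sum>t\<le>n. \<Sum>s\<le>n. of_nat s * w s t)"
    unfolding P_def sum_distrib_left by (rule sum.swap)
  also have "\<dots> = - c"
    unfolding c_def Q_def sum_negf[symmetric] by (intro sum.cong refl, subst anti) simp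
  finally have sP: "(\<Sum>s\<le>n. of_nat s * P s) = - c" .
  have "(\<Sum>s\<le>n. d s) = c * (\<Sum>s\<le>n. w s r) - Q r * (\<Sum>s\<le>n. P s) + P r * (\<Sum>s\<le>n. Q s)"
    by (simp add: d_def sum.distrib sum_subtractf sum_distrib_left)
  then have jet0: "(\<Sum>s\<le>n. d s) = 0" by (simp add: wr P0 c_def)
  have "(\<Sum>s\<le>n. of_nat s * d s) =
    c * (\<Sum>s\<le>n. of_nat s * w s r) - Q r * (\<Sum>s\<le>n. of_nat s * P s) + P r * (\<Sum>s\<le>n. of_nat s * Q s)"
    by (simp add: d_def sum.distrib sum_subtractf sum_distrib_left algebra_simps)
  then have jet1: "(\<Sum>s\<le>n. of_nat s * d s) = 0" by (simp add: swr sP sQ)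
  have "coeff ([:-1, 1:] ^ (2 * n - 2) * (\<Sum>s\<le>n. smult (d s) (mobius_basis n s))) (3 * k + 2) = 0" for k
  proof -
    define L where "L s = coeff ([:-1, 1:] ^ (2 * n - 2) * mobius_basis n s) (3 * k + 2)" for s
    have L: "(\<Sum>s\<le>n. w s t * L s) = 0" if "t \<le> n" for t
      using cols[OF that, of k] unfolding coeff_mult_mobius_sum L_def .
    have eL: "(\<Sum>s\<le>n. (\<Sum>t\<le>n. e t * w s t) * L s) = 0" for e
    proof -
      have "(\<Sum>s\<le>n. (\<Sum>t\<le>n. e t * w s t) * L s) = (\<Sum>t\<le>n. \<Sum>s\<le>n. e t * (w s t * L s))"
        unfolding sum_distrib_right mult.assoc by (rule sum.swap)
      also have "\<dots> = 0" using L by (simp flip: sum_distrib_left)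
      finally show ?thesis .
    qed
    have "(\<Sum>s\<le>n. d s * L s) =
      c * (\<Sum>s\<le>n. w s r * L s) - Q r * (\<Sum>s\<le>n. P s * L s) + P r * (\<Sum>s\<le>n. Q s * L s)"
      by (simp add: d_def sum.distrib sum_subtractf sum_distrib_left algebra_simps)
    also have "\<dots> = 0"
      using L[OF rs(1)] eL[of "\<lambda>_. 1"] eL[of of_nat] by (simp add: P_def Q_def)
    finally show ?thesis unfolding coeff_mult_mobius_sum L_def .
  qed
  from mobius_combination_unique[OF n this jet0 jet1 rs(2)]
  have "d s = 0" .
  then show ?thesis by (simp add: d_def c_def algebra_simps)
qed

section \<open>The mixed difference and its inverse\<close>

definition mixed_diff :: "(nat \<Rightarrow> nat \<Rightarrow> 'a::comm_ring_1) \<Rightarrow> nat \<Rightarrow> nat \<Rightarrow> 'a" where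
  "mixed_diff y i j = y i j - y i (Suc j) + y (Suc i) (Suc j)"

lemma mixed_diff_sum:
  fixes y :: "nat \<Rightarrow> nat \<Rightarrow> 'a::comm_ring_1"
  assumes y: "\<And>i j. \<not> (1 \<le> i \<and> i < j \<and> j \<le> n) \<Longrightarrow> y i j = 0"
  shows "(\<Sum>s\<le>n. \<Sum>t\<le>n. mixed_diff y s t * u ^ s * v ^ t) =
    (\<Sum>b<n. \<Sum>a<b. y (Suc a) (Suc b) * (u ^ a * v ^ b * (1 - u + u * v)))"
proof -
  have y0: "y 0 t = 0" "y t 0 = 0" "y (Suc n) t = 0" "y t (Suc n) = 0" for t
    by (rule y, simp)+
  have 1: "(\<Sum>s\<le>n. \<Sum>t\<le>n. y s t * u ^ s * v ^ t) =
    (\<Sum>a<n. \<Sum>b<n. y (Suc a) (Suc b) * u ^ Suc a * v ^ Suc b)"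
    unfolding lessThan_Suc_atMost[symmetric] sum.lessThan_Suc_shift by (simp add: y0)
  have 2: "(\<Sum>s\<le>n. \<Sum>t\<le>n. y s (Suc t) * u ^ s * v ^ t) =
    (\<Sum>a<n. \<Sum>b<n. y (Suc a) (Suc b) * u ^ Suc a * v ^ b)"
    unfolding lessThan_Suc_atMost[symmetric]
    by (subst sum.lessThan_Suc_shift) (simp add: y0)
  have 3: "(\<Sum>s\<le>n. \<Sum>t\<le>n. y (Suc s) (Suc t) * u ^ s * v ^ t) =
    (\<Sum>a<n. \<Sum>b<n. y (Suc a) (Suc b) * u ^ a * v ^ b)"
    unfolding lessThan_Suc_atMost[symmetric] by (simp add: y0)
  have "(\<Sum>s\<le>n. \<Sum>t\<le>n. mixed_diff y s t * u ^ s * v ^ t) =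
    (\<Sum>a<n. \<Sum>b<n. y (Suc a) (Suc b) * (u ^ a * v ^ b * (1 - u + u * v)))"
  proof -
    have "(\<Sum>s\<le>n. \<Sum>t\<le>n. mixed_diff y s t * u ^ s * v ^ t) =
      (\<Sum>s\<le>n. \<Sum>t\<le>n. y s t * u ^ s * v ^ t) - (\<Sum>s\<le>n. \<Sum>t\<le>n. y s (Suc t) * u ^ s * v ^ t) +
      (\<Sum>s\<le>n. \<Sum>t\<le>n. y (Suc s) (Suc t) * u ^ s * v ^ t)"
      unfolding sum_subtractf[symmetric] sum.distrib[symmetric] mixed_diff_def
      by (intro sum.cong refl) (simp add: algebra_simps)
    also have "\<dots> = (\<Sum>a<n. \<Sum>b<n. y (Suc a) (Suc b) * (u ^ a * v ^ b * (1 - u + u * v)))"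
      unfolding 1 2 3 sum_subtractf[symmetric] sum.distrib[symmetric]
      by (intro sum.cong refl) (simp add: algebra_simps)
    finally show ?thesis .
  qed
  also have "\<dots> = (\<Sum>b<n. \<Sum>a<n. y (Suc a) (Suc b) * (u ^ a * v ^ b * (1 - u + u * v)))"
    by (rule sum.swap)
  also have "\<dots> = (\<Sum>b<n. \<Sum>a<b. y (Suc a) (Suc b) * (u ^ a * v ^ b * (1 - u + u * v)))"
    by (intro sum.cong refl sum.mono_neutral_right) (auto simp: y)
  finally show ?thesis .
qed

text \<open>
  With shift operators \<open>E\<close> in \<open>i\<close> and \<open>E'\<close> in \<open>j\<close>, \<open>mixed_diff\<close> is \<open>1 - (1 - E) E'\<close>, whose inverse is the
  geometric series of the powers \<open>(1 - E)\<^sup>p E'\<^sup>p\<close>.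
\<close>

lemma mixed_diff_inverse:
  fixes y :: "nat \<Rightarrow> nat \<Rightarrow> 'a::comm_ring_1"
  shows "y i j = (\<Sum>p<m. \<Sum>q\<le>p. (-1) ^ q * of_nat (p choose q) * mixed_diff y (i + q) (j + p)) +
    (\<Sum>q\<le>m. (-1) ^ q * of_nat (m choose q) * y (i + q) (j + m))"
proof (induction m)
  case (Suc m)
  define z where "z q = y (i + q) (j + Suc m)" for q
  \<comment> \<open>Pascal's rule: the m-th alternating difference of \<open>z q - z (Suc q)\<close>
    is the next alternating difference of \<open>z\<close>.\<close>
  have pascal: "(\<Sum>q\<le>Suc m. (-1) ^ q * of_nat (Suc m choose q) * z q) =
    (\<Sum>q\<le>m. (-1) ^ q * of_nat (m choose q) * (z q - z (Suc q)))"
  proof -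
    have "(\<Sum>q\<le>m. (-1) ^ q * of_nat (m choose q) * z q) =
      (\<Sum>q\<le>Suc m. (-1) ^ q * of_nat (m choose q) * z q)" by (simp add: binomial_eq_0)
    also have "\<dots> = z 0 - (\<Sum>q\<le>m. (-1) ^ q * of_nat (m choose Suc q) * z (Suc q))"
      unfolding sum.atMost_Suc_shift by (simp add: sum_negf)
    finally have "(\<Sum>q\<le>m. (-1) ^ q * of_nat (m choose q) * (z q - z (Suc q))) =
      z 0 - (\<Sum>q\<le>m. (-1) ^ q * of_nat (m choose Suc q) * z (Suc q)) -
      (\<Sum>q\<le>m. (-1) ^ q * of_nat (m choose q) * z (Suc q))"
      by (simp add: right_diff_distrib sum_subtractf)
    also have "\<dots> = (\<Sum>q\<le>Suc m. (-1) ^ q * of_nat (Suc m choose q) * z q)"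
      unfolding sum.atMost_Suc_shift by (simp add: sum_negf sum.distrib sum_subtractf algebra_simps)
    finally show ?thesis by simp
  qed
  have "(\<Sum>q\<le>m. (-1) ^ q * of_nat (m choose q) * y (i + q) (j + m)) =
    (\<Sum>q\<le>m. (-1) ^ q * of_nat (m choose q) * mixed_diff y (i + q) (j + m)) +
    (\<Sum>q\<le>m. (-1) ^ q * of_nat (m choose q) * (z q - z (Suc q)))"
    unfolding sum.distrib[symmetric]
    by (intro sum.cong refl) (simp add: mixed_diff_def z_def algebra_simps)
  then show ?case
    using Suc pascal by (simp add: z_def add.assoc)
qed simp

section \<open>Refined counts: states, boundary values and positivity\<close>

lemma A2_eq: "1 \<le> k \<Longrightarrow> k \<le> n \<Longrightarrow> A2 n (int k) = \<alpha> (gaps 1 (mark1 (k - 1) n))"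
  by (subst gaps_mark1) (auto simp: A2_def)

lemma A2_last: "n \<ge> 1 \<Longrightarrow> A2 n (int n) = A1 (n - 1)"
proof -
  assume n: "n \<ge> 1"
  then have "[1..int n] = [1..int (n - 1)] @ [int n]" by (simp add: upto_rec2 of_nat_diff)
  then show ?thesis using n by (simp add: A2_def A1_def of_nat_diff)
qed

lemma A3_eq: "i < j \<Longrightarrow> j < n \<Longrightarrow> A3 n (int (Suc i)) (int (Suc j)) = \<alpha> (gaps 1 (mark2 i j n))"
  by (subst gaps_mark2) (auto simp: A3_def add.commute)

lemma A3_last: "1 \<le> i \<Longrightarrow> i < n \<Longrightarrow> A3 n (int i) (int n) = A2 (n - 1) (int i)"
proof -
  assume i: "1 \<le> i" "i < n"
  then have "[1..int n] = [1..int (n - 1)] @ [int n]" by (simp add: upto_rec2 of_nat_diff)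
  then show ?thesis using i by (simp add: A2_def A3_def of_nat_diff)
qed

lemma A1_pos: "A1 n > 0"
proof -
  let ?t = "restrict (\<lambda>(i, j). int j) (triangle_index n)"
  have "monotone_triangle n ?t"
    unfolding monotone_triangle_def by (auto simp: triangle_index_def)
  moreover have "bottom_row n ?t = [1..int n]"
    unfolding bottom_row_eq_iff by (auto simp: triangle_index_def)
  ultimately have "?t \<in> monotone_triangles [1..int n]" by (simp add: monotone_triangles_def)
  then show ?thesis
    unfolding A1_def \<alpha>_def using finite_monotone_triangles by (auto simp: card_gt_0_iff)
qed

lemma length_gaps_mark1: "j < n \<Longrightarrow> length (gaps 1 (mark1 j n)) = n - 1"
proof -
  assume "j < n"
  then have "set (gaps 1 (mark1 j n)) = {1..int n} - {int j + 1}" by (auto simp: gaps_mark1)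
  moreover have "distinct (gaps 1 (mark1 j n))" using sorted_gaps strict_sorted_iff by blast
  moreover have "card ({1..int n} - {int j + 1}) = n - 1"
    using \<open>j < n\<close> by (subst card_Diff_subset) auto
  ultimately show ?thesis by (metis distinct_card)
qed

lemma length_gaps_mark2: "i < j \<Longrightarrow> j < n \<Longrightarrow> length (gaps 1 (mark2 i j n)) = n - 2"
proof -
  assume ij: "i < j" "j < n"
  then have "set (gaps 1 (mark2 i j n)) = {1..int n} - {int i + 1, int j + 1}" by (auto simp: gaps_mark2)
  moreover have "distinct (gaps 1 (mark2 i j n))" using sorted_gaps strict_sorted_iff by blast
  moreover have "card ({1..int n} - {int i + 1, int j + 1}) = n - 2"
    using ij by (subst card_Diff_subset) auto
  ultimately show ?thesis by (metis distinct_card)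
qed

lemma sum_by_parts:
  fixes a :: "nat \<Rightarrow> 'a::comm_ring_1"
  shows "(\<Sum>t\<le>n. of_nat t * (a (Suc t) - a t)) = of_nat n * a (Suc n) - (\<Sum>t<n. a (Suc t))"
  by (induction n) (simp_all add: algebra_simps)

lemma sum_diff_power:
  fixes a :: "nat \<Rightarrow> 'a::comm_ring_1"
  assumes "a 0 = 0" "a (Suc n) = 0"
  shows "(\<Sum>s\<le>n. (a (Suc s) - a s) * u ^ s) = (1 - u) * (\<Sum>s<n. u ^ s * a (Suc s))"
proof -
  have "(\<Sum>s\<le>n. a (Suc s) * u ^ s) = (\<Sum>s<n. u ^ s * a (Suc s))"
    unfolding lessThan_Suc_atMost[symmetric] using assms by (simp add: mult.commute)
  moreover have "(\<Sum>s\<le>n. a s * u ^ s) = u * (\<Sum>s<n. u ^ s * a (Suc s))"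
    unfolding lessThan_Suc_atMost[symmetric] sum.lessThan_Suc_shift
    using assms by (simp add: sum_distrib_left mult_ac)
  ultimately show ?thesis by (simp add: left_diff_distrib sum_subtractf)
qed

text \<open>In the wedge formula the row sums \<open>P\<close> and the last column of
  \<open>w\<close> are known counts; the unknown \<open>Q\<close> is eliminated with row
  \<open>n\<close>.\<close>

lemma mixed_diff_A3:
  fixes y :: "nat \<Rightarrow> nat \<Rightarrow> int"
  assumes n: "n \<ge> 2"
    and y_def: "y = (\<lambda>i j. if 1 \<le> i \<and> i < j \<and> j \<le> n then int (A3 n (int i) (int j)) else 0)"
    and st: "s < t" "t \<le> n"
  shows "int (A1 (n - 1)) * mixed_diff y s t =
    int (A2 (n - 1) (int t)) * (int (A2 n (int (Suc s))) - int (A2 n (int s))) -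
    int (A2 (n - 1) (int s)) * (int (A2 n (int (Suc t))) - int (A2 n (int t)))"
proof -
  define a where "a k = complex_of_nat (A2 n (int k))" for k
  define yc where "yc i j = complex_of_int (y i j)" for i j
  define w where "w s t = mixed_diff yc s t - mixed_diff yc t s" for s t
  define P where "P s = (\<Sum>t\<le>n. w s t)" for s
  define Q where "Q s = (\<Sum>t\<le>n. of_nat t * w s t)" for s
  define c where "c = (\<Sum>s\<le>n. Q s)"
  let ?ones = "\<lambda>m. replicate m (replicate n (1, 1, 1)) :: complex weights list list"
  have anti: "w t s = - w s t" for s t by (simp add: w_def)
  have yc0: "yc i j = 0" if "\<not> (1 \<le> i \<and> i < j \<and> j \<le> n)" for i j
    using that by (auto simp: yc_def y_def)
  have yc1: "yc (Suc i) (Suc j) = partition_fn (?ones (n - 2)) (mark2 i j n)" if "i < j" "j < n" for i j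
  proof -
    have "length (mark2 i j n) = n" by (simp add: mark2_def)
    from partition_fn_ones[OF length_gaps_mark2[OF that] this, where 'a = complex] show ?thesis
      using that by (simp add: yc_def y_def A3_eq[symmetric])
  qed
  have a0: "a 0 = 0" "a (Suc n) = 0" by (simp_all add: a_def A2_def)
  have a1: "a (Suc j) = partition_fn (?ones (n - 1)) (mark1 j n)" if "j < n" for j
  proof -
    have "length (mark1 j n) = n" by (simp add: mark1_def)
    from partition_fn_ones[OF length_gaps_mark1[OF that] this, where 'a = complex] show ?thesis
      using that A2_eq[of "Suc j" n] by (simp add: a_def)
  qed
  have w_sum: "(\<Sum>s\<le>n. \<Sum>t\<le>n. w s t * u ^ s * v ^ t) =
      (v - u) * two_rows u v False False n (partition_fn (?ones (n - 2)))" for u v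
  proof -
    have m: "(\<Sum>s\<le>n. \<Sum>t\<le>n. mixed_diff yc s t * u ^ s * v ^ t) =
      (\<Sum>b<n. \<Sum>a<b. yc (Suc a) (Suc b) * (u ^ a * v ^ b * (1 - u + u * v)))" for u v
      by (rule mixed_diff_sum) (rule yc0)
    have "(\<Sum>s\<le>n. \<Sum>t\<le>n. w s t * u ^ s * v ^ t) =
      (\<Sum>s\<le>n. \<Sum>t\<le>n. mixed_diff yc s t * u ^ s * v ^ t) -
      (\<Sum>s\<le>n. \<Sum>t\<le>n. mixed_diff yc t s * u ^ s * v ^ t)"
      by (simp add: w_def left_diff_distrib sum_subtractf)
    also have "(\<Sum>s\<le>n. \<Sum>t\<le>n. mixed_diff yc t s * u ^ s * v ^ t) =
      (\<Sum>t\<le>n. \<Sum>s\<le>n. mixed_diff yc t s * v ^ t * u ^ s)"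
      by (subst sum.swap) (simp add: mult_ac)
    also have "(\<Sum>s\<le>n. \<Sum>t\<le>n. mixed_diff yc s t * u ^ s * v ^ t) - \<dots> =
      - (\<Sum>b<n. \<Sum>a<b. (u ^ b * v ^ a * (1 - v + u * v) - u ^ a * v ^ b * (1 - u + u * v)) *
          partition_fn (?ones (n - 2)) (mark2 a b n))"
      unfolding m
      unfolding sum_subtractf[symmetric] sum_negf[symmetric]
      by (intro sum.cong refl) (simp add: yc1 algebra_simps)
    also have "\<dots> = - ((u - v) * two_rows u v False False n (partition_fn (?ones (n - 2))))"
      unfolding two_rows_eq ..
    finally show ?thesis by (simp add: algebra_simps)
  qed
  have P: "P s = a (Suc s) - a s" if "s \<le> n" for s
  proof -
    \<comment> \<open>At v = 1 the second general row becomes one more row of ones, and a single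
      general row generates the counts \<open>a\<close>.\<close>
    have "(\<Sum>s\<le>n. (P s - (a (Suc s) - a s)) * u ^ s) = 0" for u
    proof -
      have "(\<Sum>s\<le>n. P s * u ^ s) = (\<Sum>s\<le>n. \<Sum>t\<le>n. w s t * u ^ s * 1 ^ t)"
        by (simp add: P_def sum_distrib_right)
      also have "\<dots> = (1 - u) * two_rows u 1 False False n (partition_fn (?ones (n - 2)))"
        by (rule w_sum)
      also have "two_rows u 1 False False n (partition_fn (?ones (n - 2))) =
        transfer False (replicate n (hom_weights u)) (replicate n False) (partition_fn (?ones (n - 1)))"
      proof -
        have "?ones (n - 1) = replicate n (1, 1, 1) # ?ones (n - 2)"
          using n by (simp flip: replicate_Suc)
        then have "partition_fn (?ones (n - 1)) =
          (\<lambda>s. transfer False (replicate n (1, 1, 1)) s (partition_fn (?ones (n - 2))))"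
          by (intro ext) simp
        then show ?thesis by (simp add: hom_weights_def[of 1])
      qed
      also have "\<dots> = (\<Sum>j<n. u ^ j * a (Suc j))"
        unfolding transfer_False_hom by (simp add: a1)
      also have "(1 - u) * \<dots> = (\<Sum>s\<le>n. (a (Suc s) - a s) * u ^ s)"
        using sum_diff_power[of a n u] a0 by simp
      finally show ?thesis by (simp add: left_diff_distrib sum_subtractf)
    qed
    then show ?thesis
      using power_sum_zero_cofinite[of "{}" "\<lambda>s. P s - (a (Suc s) - a s)" n s] that by simp
  qed
  have "c = (\<Sum>t\<le>n. of_nat t * (\<Sum>s\<le>n. w s t))"
    unfolding c_def Q_def sum_distrib_left by (rule sum.swap)
  also have "\<dots> = (\<Sum>t\<le>n. - (of_nat t * P t))"
    unfolding P_def sum_negf[symmetric] mult_minus_right[symmetric]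
    by (intro sum.cong refl arg_cong2[where f = "(*)"] anti)
  also have "\<dots> = (\<Sum>t<n. a (Suc t))"
    using sum_by_parts[of a n] by (simp add: P sum_negf a0)
  also have "\<dots> = of_nat (\<Sum>t<n. A2 n (int (Suc t)))" by (simp add: a_def)
  finally have c: "c = of_nat (\<Sum>t<n. A2 n (int (Suc t)))" .
  have an: "a n = of_nat (A1 (n - 1))" using A2_last[of n] n by (simp add: a_def)
  have "A2 n (int (Suc (n - 1))) > 0" using A2_last[of n] A1_pos n by simp
  then have "(\<Sum>t<n. A2 n (int (Suc t))) > 0"
    using n by (intro sum_pos2[of _ "n - 1"]) auto
  then have c0: "c \<noteq> 0" unfolding c by (simp only: of_nat_eq_0_iff)
  \<comment> \<open>Only A_{n,s,n} = A_{n-1,s} survives in the last column; for s = 0 and s = n both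
    sides are 0 by convention.\<close>
  have R: "w s n = of_nat (A2 (n - 1) (int s))" if "s \<le> n" for s
  proof -
    have "w s n = yc s n" by (simp add: w_def mixed_diff_def yc0)
    also have "\<dots> = of_nat (A2 (n - 1) (int s))"
    proof (cases "1 \<le> s \<and> s < n")
      case True
      then show ?thesis using A3_last[of s n] by (simp add: yc_def y_def)
    next
      case False
      then have "s = 0 \<or> s = n" using that by auto
      then show ?thesis using n by (auto simp: yc0 A2_def)
    qed
    finally show ?thesis .
  qed
  have wedge: "c * w s r = Q r * P s - P r * Q s" if "r \<le> n" "s \<le> n" for r s
    unfolding c_def P_def Q_def
    using n that by (intro wedge_formula anti two_rows_columns[OF n w_sum]) auto
  have Pn: "P n = - a n" using P[of n] a0 by simp
  have Rn: "a n * Q s = c * w s n - Q n * P s" if "s \<le> n" for s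
    using wedge[OF order.refl that] Pn by simp
  have "c * (a n * w s t) = a n * (c * w s t)" by (rule mult.left_commute)
  also have "c * w s t = Q t * P s - P t * Q s" using wedge[of t s] st by simp
  also have "a n * \<dots> = P s * (a n * Q t) - P t * (a n * Q s)" by (simp add: algebra_simps)
  \<comment> \<open>The two terms containing \<open>Q n\<close> cancel, leaving \<open>c\<close> as
    a common nonzero factor.\<close>
  also have "\<dots> = c * (P s * w t n - P t * w s n)"
    unfolding Rn[OF st(2)] Rn[OF order.trans[OF less_imp_le[OF st(1)] st(2)]] by (simp add: algebra_simps)
  finally have main: "a n * w s t = P s * w t n - P t * w s n" using c0 by simp
  have "w s t = of_int (mixed_diff y s t)"
  proof -
    have "mixed_diff yc t s = 0" using st by (simp add: mixed_diff_def yc0)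
    then show ?thesis by (simp add: w_def mixed_diff_def yc_def)
  qed
  then have "complex_of_int (int (A1 (n - 1)) * mixed_diff y s t) = complex_of_int (
    int (A2 (n - 1) (int t)) * (int (A2 n (int (Suc s))) - int (A2 n (int s))) -
    int (A2 (n - 1) (int s)) * (int (A2 n (int (Suc t))) - int (A2 n (int t))))"
    using main st by (simp add: P R an) (simp add: a_def algebra_simps)
  then show ?thesis by (simp only: of_int_eq_iff)
qed

theorem theorem1:
  fixes n :: nat and i j :: int
  assumes "n \<ge> 2"
    and "1 \<le> i" and "i < j" and "j \<le> int n"
  shows "(of_nat (A3 n i j) :: rat) =
    (\<Sum>p=0..nat (int n - j). \<Sum>q=0..p.
       (-1) ^ q * of_nat (p choose q) * X n (i + int q) (j + int p))"
proof -
  \<comment> \<open>The cut-off matters: \<open>A3\<close> itself need not vanish outside the range,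
    since \<open>removeAll\<close> ignores absent entries.\<close>
  define y where "y = (\<lambda>i j. if 1 \<le> i \<and> i < j \<and> j \<le> n then int (A3 n (int i) (int j)) else 0)"
  define yr where "yr i j = rat_of_int (y i j)" for i j
  have X: "X n (int s) (int t) = mixed_diff yr s t" if "s < t" "t \<le> n" for s t
  proof -
    have "rat_of_int (int (A1 (n - 1)) * mixed_diff y s t) = rat_of_int (
      int (A2 (n - 1) (int t)) * (int (A2 n (int (Suc s))) - int (A2 n (int s))) -
      int (A2 (n - 1) (int s)) * (int (A2 n (int (Suc t))) - int (A2 n (int t))))"
      by (simp only: mixed_diff_A3[OF assms(1) y_def that])
    moreover have "mixed_diff yr s t = of_int (mixed_diff y s t)"
      by (simp add: mixed_diff_def yr_def)
    ultimately show ?thesis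
      using A1_pos[of "n - 1"] by (simp add: X_def field_simps)
  qed
  define i' where "i' = nat i"
  define j' where "j' = nat j"
  have ij: "i = int i'" "j = int j'" "1 \<le> i'" "i' < j'" "j' \<le> n"
    using assms by (auto simp: i'_def j'_def)
  have "of_nat (A3 n i j) = yr i' j'" using ij by (simp add: yr_def y_def)
  \<comment> \<open>With n - j' + 1 steps the second index in the remainder is n + 1, where
    \<open>yr\<close> is 0.\<close>
  also have "\<dots> = (\<Sum>p<Suc (n - j'). \<Sum>q\<le>p. (-1) ^ q * of_nat (p choose q) * mixed_diff yr (i' + q) (j' + p)) +
    (\<Sum>q\<le>Suc (n - j'). (-1) ^ q * of_nat (Suc (n - j') choose q) * yr (i' + q) (j' + Suc (n - j')))"
    by (rule mixed_diff_inverse)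
  also have "(\<Sum>q\<le>Suc (n - j'). (-1) ^ q * of_nat (Suc (n - j') choose q) * yr (i' + q) (j' + Suc (n - j'))) = 0"
    using ij by (intro sum.neutral) (simp add: yr_def y_def)
  also have "(\<Sum>p<Suc (n - j'). \<Sum>q\<le>p. (-1) ^ q * of_nat (p choose q) * mixed_diff yr (i' + q) (j' + p)) =
    (\<Sum>p=0..nat (int n - j). \<Sum>q=0..p. (-1) ^ q * of_nat (p choose q) * X n (i + int q) (j + int p))"
  proof (intro sum.cong)
    show "{..<Suc (n - j')} = {0..nat (int n - j)}" using ij by auto
    fix p q assume "p \<in> {0..nat (int n - j)}" "q \<in> {0..p}"
    then have "i' + q < j' + p" "j' + p \<le> n" using ij by auto
    from X[OF this] show "(-1) ^ q * of_nat (p choose q) * mixed_diff yr (i' + q) (j' + p) =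
      (-1) ^ q * of_nat (p choose q) * X n (i + int q) (j + int p)"
      using ij by simp
  qed auto
  finally show ?thesis by simp
qed

end
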